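(* Assume that $X\subset\mathbb{P}^n$ is smooth, defined over $\mathbb{Q}$ and $\mathbb{Q}$-unirational, so that there exist $m\in\mathbb{N}$, forms $f_0,\ldots,f_n\in\mathbb{Z}[x_0,\ldots,x_m]$ and a dominant rational map $\pi:\mathbb{P}^m\dashrightarrow X$ given by $\pi=(f_0:\ldots:f_n)$. Let $f:=\prod_{i=0}^n f_i$. Then the saturation number $r(X)$ is at most $$10^5\,(\deg f)^7\,\log(2\|f\|),$$ where $\|f\|$ is the maximum of the absolute values of the coefficients of $f$.
   Context: For an integer $m$, $\Omega(m):=\sum_p \nu_p(m)$ is the number of prime divisors of $m$ counted with multiplicity ($\nu_p$ is the $p$-adic valuation), with $\Omega(m)=\infty$ if and only if $m=0$. For $x\in\mathbb{P}^n(\mathbb{Q})$ write $x=[\mathbf{x}]$ with $\mathbf{x}=(x_0,\ldots,x_n)\in\mathbb{Z}^{n+1}$, $\gcd(x_0,\ldots,x_n)=1$, and put $\Omega_{\mathbb{P}^n(\mathbb{Q})}(x):=\Omega\big(\prod_{i=0}^n x_i\big)$; this is well defined. Saturation number: for a variety $X\subset\mathbb{P}^n$ defined over $\mathbb{Q}$, $r(X)$ is the least $r\in\mathbb{N}\cup\{\infty\}$ such that the set of points $x\in X(\mathbb{Q})$ with $\Omega_{\mathbb{P}^n(\mathbb{Q})}(x)\leq r$ is Zariski dense in $X$. A variety $X$ over $\mathbb{Q}$ is $\mathbb{Q}$-unirational if there exist a positive integer $m$ and a dominant rational map $\mathbb{P}^m\dashrightarrow X$ defined over $\mathbb{Q}$.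 A form is a homogeneous polynomial.
   Formalization: The formal theorem assumes f ≠ 0 (otherwise log(2‖f‖) is undefined) and that the forms f_i have positive degree; for constant f_i the bound is 0 and fails, e.g. X = {[2:1]} with π = (2:1), where r(X) = 1. *)

theory Defs
  imports
    "HOL-Analysis.Analysis"
    "HOL-Computational_Algebra.Primes"
    "HOL-Library.Poly_Mapping"
    "HOL-Library.Function_Algebras"
begin

section \<open>Forms in several variables\<close>

text \<open>Polynomials in the variables \<open>x\<^sub>0, x\<^sub>1, \<dots>\<close>; a monomial is the finitely supported
  function of its exponents.  Polynomials over a subring \<open>R\<close> of the complex numbers are those
  all of whose coefficients lie in \<open>R\<close>.\<close>

type_synonym cpoly = "(nat \<Rightarrow>\<^sub>0 nat) \<Rightarrow>\<^sub>0 complex"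

abbreviation coefficient :: "cpoly \<Rightarrow> (nat \<Rightarrow>\<^sub>0 nat) \<Rightarrow> complex"
  where "coefficient \<equiv> Poly_Mapping.lookup"

abbreviation monomials :: "cpoly \<Rightarrow> (nat \<Rightarrow>\<^sub>0 nat) set"
  where "monomials \<equiv> Poly_Mapping.keys"

abbreviation vars :: "(nat \<Rightarrow>\<^sub>0 nat) \<Rightarrow> nat set"
  where "vars \<equiv> Poly_Mapping.keys"

definition mon_degree :: "(nat \<Rightarrow>\<^sub>0 nat) \<Rightarrow> nat"
  where "mon_degree a = (\<Sum>i\<in>vars a. Poly_Mapping.lookup a i)"

definition mon_eval :: "(nat \<Rightarrow> complex) \<Rightarrow> (nat \<Rightarrow>\<^sub>0 nat) \<Rightarrow> complex"
  where "mon_eval v a = (\<Prod>i\<in>vars a. v i ^ Poly_Mapping.lookup a i)"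

definition peval :: "cpoly \<Rightarrow> (nat \<Rightarrow> complex) \<Rightarrow> complex"
  where "peval p v = (\<Sum>a\<in>monomials p. coefficient p a * mon_eval v a)"

definition total_degree :: "cpoly \<Rightarrow> nat"
  where "total_degree p = Max (insert 0 (mon_degree ` monomials p))"

definition max_coeff :: "cpoly \<Rightarrow> real"
  where "max_coeff p = Max (range (\<lambda>a. cmod (coefficient p a)))"

text \<open>The forms of degree \<open>d\<close> (zero included) in \<open>R[x\<^sub>0, \<dots>, x\<^sub>n]\<close>.\<close>

definition forms :: "complex set \<Rightarrow> nat \<Rightarrow> nat \<Rightarrow> cpoly set"
  where "forms R n d =
    {p. \<forall>a\<in>monomials p. coefficient p a \<in> R \<and> vars a \<subseteq> {..n} \<and> mon_degree a = d}"

definition partial_deriv :: "nat \<Rightarrow> cpoly \<Rightarrow> cpoly"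
  where "partial_deriv i p =
    (\<Sum>a\<in>monomials p. Poly_Mapping.single (a - Poly_Mapping.single i 1)
       (of_nat (Poly_Mapping.lookup a i) * coefficient p a))"

definition gradient :: "cpoly \<Rightarrow> (nat \<Rightarrow> complex) \<Rightarrow> nat \<Rightarrow> complex"
  where "gradient p v = (\<lambda>i. peval (partial_deriv i p) v)"

lemma mon_eval_superset:
  assumes "finite S" "vars a \<subseteq> S"
  shows "mon_eval v a = (\<Prod>i\<in>S. v i ^ Poly_Mapping.lookup a i)"
  unfolding mon_eval_def using assms
  by (intro prod.mono_neutral_left) (auto simp: in_keys_iff)

lemma mon_eval_add: "mon_eval v (a + b) = mon_eval v a * mon_eval v b"
proof -
  let ?S = "vars a \<union> vars b"
  have "vars (a + b) \<subseteq> ?S" by (rule keys_add)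
  then show ?thesis
    by (simp add: mon_eval_superset[of ?S] lookup_add power_add prod.distrib)
qed

lemma mon_degree_superset:
  assumes "finite S" "vars a \<subseteq> S"
  shows "mon_degree a = (\<Sum>i\<in>S. Poly_Mapping.lookup a i)"
  unfolding mon_degree_def using assms
  by (intro sum.mono_neutral_left) (auto simp: in_keys_iff)

lemma mon_degree_add: "mon_degree (a + b) = mon_degree a + mon_degree b"
proof -
  let ?S = "vars a \<union> vars b"
  have "vars (a + b) \<subseteq> ?S" by (rule keys_add)
  then show ?thesis
    by (simp add: mon_degree_superset[of ?S] lookup_add sum.distrib)
qed

lemma mon_eval_scale: "mon_eval (\<lambda>i. c * v i) a = c ^ mon_degree a * mon_eval v a"
  by (simp add: mon_eval_def mon_degree_def power_mult_distrib prod.distrib power_sum)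

lemma peval_superset:
  assumes "finite S" "monomials p \<subseteq> S"
  shows "peval p v = (\<Sum>a\<in>S. coefficient p a * mon_eval v a)"
  unfolding peval_def using assms
  by (intro sum.mono_neutral_left) (auto simp: in_keys_iff)

lemma peval_0 [simp]: "peval 0 v = 0"
  by (simp add: peval_def)

lemma peval_1 [simp]: "peval 1 v = 1"
  by (simp add: peval_def mon_eval_def lookup_one)

lemma peval_single [simp]: "peval (Poly_Mapping.single a c) v = c * mon_eval v a"
  by (simp add: peval_def)

lemma peval_add: "peval (p + q) v = peval p v + peval q v"
proof -
  let ?S = "monomials p \<union> monomials q"
  have "monomials (p + q) \<subseteq> ?S" by (rule keys_add)
  then show ?thesis
    by (simp add: peval_superset[of ?S] lookup_add distrib_right sum.distrib)
qed

lemma peval_sum: "peval (\<Sum>i\<in>A. p i) v = (\<Sum>i\<in>A. peval (p i) v)"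
  by (induction A rule: infinite_finite_induct) (simp_all add: peval_add)

lemma cpoly_expand:
  fixes p :: cpoly
  shows "p = (\<Sum>a\<in>monomials p. Poly_Mapping.single a (coefficient p a))"
  by (rule poly_mapping_eqI) (simp add: lookup_sum lookup_single when_def in_keys_iff)

lemma cpoly_times_expand:
  fixes p q :: cpoly
  shows "p * q = (\<Sum>a\<in>monomials p. \<Sum>b\<in>monomials q.
           Poly_Mapping.single (a + b) (coefficient p a * coefficient q b))"
proof -
  have "p * q = (\<Sum>a\<in>monomials p. Poly_Mapping.single a (coefficient p a)) *
                (\<Sum>b\<in>monomials q. Poly_Mapping.single b (coefficient q b))"
    using cpoly_expand[of p] cpoly_expand[of q] by simp
  then show ?thesis by (simp add: sum_product mult_single)
qed

lemma peval_mult: "peval (p * q) v = peval p v * peval q v"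
proof -
  have "peval (p * q) v = (\<Sum>a\<in>monomials p. \<Sum>b\<in>monomials q.
          coefficient p a * coefficient q b * mon_eval v (a + b))"
    by (subst cpoly_times_expand) (simp add: peval_sum)
  also have "\<dots> = peval p v * peval q v"
    by (simp add: peval_def sum_product mon_eval_add mult_ac)
  finally show ?thesis .
qed

lemma peval_scale:
  assumes "p \<in> forms R n d"
  shows "peval p (\<lambda>i. c * v i) = c ^ d * peval p v"
proof -
  have "mon_degree a = d" if "a \<in> monomials p" for a
    using that assms by (auto simp: forms_def)
  then show ?thesis
    by (simp add: peval_def mon_eval_scale sum_distrib_left mult_ac)
qed

lemma one_forms: "1 \<in> R \<Longrightarrow> 1 \<in> forms R n 0"
  by (simp add: forms_def mon_degree_def lookup_one)

lemma forms_mult_Rats: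
  assumes "p \<in> forms \<rat> n d" "q \<in> forms \<rat> n e"
  shows "p * q \<in> forms \<rat> n (d + e)"
proof -
  have coeffs: "coefficient p a \<in> \<rat>" "coefficient q a \<in> \<rat>" for a
    using assms by (cases "a \<in> monomials p"; cases "a \<in> monomials q";
      force simp: forms_def in_keys_iff)+
  have "coefficient (p * q) c \<in> \<rat>" for c
    by (subst cpoly_times_expand)
       (auto simp: lookup_sum lookup_single when_def intro!: Rats_sum Rats_mult coeffs)
  moreover have "vars c \<subseteq> {..n} \<and> mon_degree c = d + e" if c: "c \<in> monomials (p * q)" for c
  proof -
    obtain a b where "a \<in> monomials p" "b \<in> monomials q" "c = a + b"
      using keys_mult[of p q] c by blast
    moreover from this have "vars a \<subseteq> {..n}" "mon_degree a = d" "vars b \<subseteq> {..n}" "mon_degree b = e"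
      using assms by (simp_all add: forms_def)
    ultimately show ?thesis
      using keys_add[of a b] by (simp add: mon_degree_add) (meson Un_least subset_trans)
  qed
  ultimately show ?thesis by (simp add: forms_def)
qed

section \<open>Projective space over the complex numbers with its rational structure\<close>

text \<open>Nonzero vectors of length \<open>n + 1\<close>, padded by zeros.\<close>

definition vectors :: "nat \<Rightarrow> (nat \<Rightarrow> complex) set"
  where "vectors n = {v. (\<exists>i\<le>n. v i \<noteq> 0) \<and> (\<forall>i>n. v i = 0)}"

text \<open>A point of projective space is the set of all its vectors of homogeneous coordinates.\<close>

type_synonym ppoint = "(nat \<Rightarrow> complex) set"

definition proj_point :: "(nat \<Rightarrow> complex) \<Rightarrow> ppoint"
  where "proj_point v = {(\<lambda>i. c * v i) |c. c \<noteq> 0}"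

definition proj_space :: "nat \<Rightarrow> ppoint set"
  where "proj_space n = proj_point ` vectors n"

definition zero_locus :: "nat \<Rightarrow> cpoly set \<Rightarrow> ppoint set"
  where "zero_locus n G = {x \<in> proj_space n. \<forall>g\<in>G. \<forall>v\<in>x. peval g v = 0}"

text \<open>The Zariski topology over \<open>\<rat>\<close> on the set of complex points: its closed sets are the
  zero loci of sets of forms with rational coefficients.\<close>

definition zariski :: "nat \<Rightarrow> ppoint topology"
  where "zariski n =
    topology (\<lambda>U. \<exists>G. G \<subseteq> (\<Union>d. forms \<rat> n d) \<and> U = proj_space n - zero_locus n G)"

lemma proj_point_self: "v \<in> proj_point v"
  unfolding proj_point_def by (auto intro!: exI[of _ 1])

lemma proj_point_scale:
  assumes "c \<noteq> 0"
  shows "proj_point (\<lambda>i. c * v i) = proj_point v"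
proof (intro equalityI subsetI)
  fix w assume "w \<in> proj_point (\<lambda>i. c * v i)"
  then obtain e where e: "e \<noteq> 0" "w = (\<lambda>i. e * (c * v i))"
    unfolding proj_point_def by blast
  show "w \<in> proj_point v"
    unfolding proj_point_def mem_Collect_eq
    using assms e by (intro exI[of _ "e * c"]) (simp add: mult.assoc)
next
  fix w assume "w \<in> proj_point v"
  then obtain e where e: "e \<noteq> 0" "w = (\<lambda>i. e * v i)"
    unfolding proj_point_def by blast
  show "w \<in> proj_point (\<lambda>i. c * v i)"
    unfolding proj_point_def mem_Collect_eq
    using assms e by (intro exI[of _ "e / c"]) simp
qed

lemma vanishing_rep:
  assumes "g \<in> forms R n d" "x = proj_point w" "v \<in> x"
  shows "(\<forall>v\<in>x. peval g v = 0) \<longleftrightarrow> peval g v = 0"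
  using assms peval_scale[OF assms(1)] by (auto simp: proj_point_def)

lemma zero_locus_UN: "proj_space n - zero_locus n (\<Union>\<G>) = (\<Union>G\<in>\<G>. proj_space n - zero_locus n G)"
  by (auto simp: zero_locus_def)

lemma zero_locus_products:
  assumes "G \<subseteq> (\<Union>d. forms \<rat> n d)" "H \<subseteq> (\<Union>d. forms \<rat> n d)"
  shows "zero_locus n {g * h |g h. g \<in> G \<and> h \<in> H} = zero_locus n G \<union> zero_locus n H"
proof (intro equalityI subsetI)
  fix x assume x: "x \<in> zero_locus n {g * h |g h. g \<in> G \<and> h \<in> H}"
  then have xn: "x \<in> proj_space n" by (simp add: zero_locus_def)
  then obtain w where w: "x = proj_point w" by (auto simp: proj_space_def)
  have wx: "w \<in> x" using w proj_point_self by simp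
  have prod: "peval g w = 0 \<or> peval h w = 0" if "g \<in> G" "h \<in> H" for g h
  proof -
    have "peval (g * h) w = 0" using x wx that by (auto simp: zero_locus_def)
    then show ?thesis by (simp add: peval_mult)
  qed
  have rep: "\<forall>v\<in>x. peval g v = 0" if "g \<in> G \<union> H" "peval g w = 0" for g
  proof -
    have "g \<in> (\<Union>d. forms \<rat> n d)" using that assms by (metis UnE subsetD)
    then obtain d where "g \<in> forms \<rat> n d" by blast
    from vanishing_rep[OF this w wx] that show ?thesis by blast
  qed
  show "x \<in> zero_locus n G \<union> zero_locus n H"
  proof (cases "\<forall>g\<in>G. peval g w = 0")
    case True
    then show ?thesis using xn rep by (auto simp: zero_locus_def)
  next
    case False
    then have "\<forall>h\<in>H. peval h w = 0" using prod by blast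
    then show ?thesis using xn rep by (auto simp: zero_locus_def)
  qed
next
  fix x assume "x \<in> zero_locus n G \<union> zero_locus n H"
  then show "x \<in> zero_locus n {g * h |g h. g \<in> G \<and> h \<in> H}"
    by (auto simp: zero_locus_def peval_mult)
qed

lemma openin_zariski:
  "openin (zariski n) U \<longleftrightarrow>
     (\<exists>G. G \<subseteq> (\<Union>d. forms \<rat> n d) \<and> U = proj_space n - zero_locus n G)"
proof -
  let ?F = "\<Union>d. forms \<rat> n d" and ?D = "\<lambda>G. proj_space n - zero_locus n G"
  have "istopology (\<lambda>U. \<exists>G. G \<subseteq> ?F \<and> U = ?D G)"
    unfolding istopology_def
  proof (intro conjI allI impI)
    fix S T assume "\<exists>G. G \<subseteq> ?F \<and> S = ?D G" "\<exists>G. G \<subseteq> ?F \<and> T = ?D G"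
    then obtain G H where G: "G \<subseteq> ?F" "S = ?D G" and H: "H \<subseteq> ?F" "T = ?D H"
      by blast
    have "{g * h |g h. g \<in> G \<and> h \<in> H} \<subseteq> ?F"
    proof
      fix k assume "k \<in> {g * h |g h. g \<in> G \<and> h \<in> H}"
      then obtain g h where k: "k = g * h" "g \<in> ?F" "h \<in> ?F"
        using G(1) H(1) by blast
      then obtain d e where "g \<in> forms \<rat> n d" "h \<in> forms \<rat> n e" by blast
      then show "k \<in> ?F" using forms_mult_Rats k(1) by blast
    qed
    moreover have "S \<inter> T = ?D {g * h |g h. g \<in> G \<and> h \<in> H}"
      unfolding zero_locus_products[OF G(1) H(1)] G(2) H(2) by blast
    ultimately show "\<exists>G. G \<subseteq> ?F \<and> S \<inter> T = ?D G" by blast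
  next
    fix \<K> assume "\<forall>K\<in>\<K>. \<exists>G. G \<subseteq> ?F \<and> K = ?D G"
    then obtain G where G: "\<And>K. K \<in> \<K> \<Longrightarrow> G K \<subseteq> ?F \<and> K = ?D (G K)"
      by metis
    have "\<Union>\<K> = ?D (\<Union>(G ` \<K>))"
      unfolding zero_locus_UN using G by auto
    moreover have "\<Union>(G ` \<K>) \<subseteq> ?F" using G by blast
    ultimately show "\<exists>G. G \<subseteq> ?F \<and> \<Union>\<K> = ?D G" by blast
  qed
  then show ?thesis by (simp add: zariski_def)
qed

lemma topspace_zariski: "topspace (zariski n) = proj_space n"
proof -
  have "zero_locus n {1} = {}"
    by (auto simp: zero_locus_def proj_space_def intro: proj_point_self)
  then have "openin (zariski n) (proj_space n)"
    unfolding openin_zariski using one_forms[of \<rat> n] by (intro exI[of _ "{1}"]) auto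
  moreover have "U \<subseteq> proj_space n" if "openin (zariski n) U" for U
    using that by (auto simp: openin_zariski)
  ultimately show ?thesis
    by (metis openin_subset openin_topspace subset_antisym)
qed

lemma closedin_zariski:
  "closedin (zariski n) Z \<longleftrightarrow> (\<exists>G. G \<subseteq> (\<Union>d. forms \<rat> n d) \<and> Z = zero_locus n G)"
proof -
  have sub: "zero_locus n G \<subseteq> proj_space n" for G by (auto simp: zero_locus_def)
  have "Z \<subseteq> proj_space n \<and> proj_space n - Z = proj_space n - zero_locus n G
          \<longleftrightarrow> Z = zero_locus n G" for G
    using sub[of G] by blast
  then show ?thesis
    unfolding closedin_def topspace_zariski openin_zariski by (metis (no_types, lifting))
qed

section \<open>Smooth projective varieties over the rationals\<close>

definition irreducible_closed :: "'a topology \<Rightarrow> 'a set \<Rightarrow> bool"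
  where "irreducible_closed T Z \<longleftrightarrow> closedin T Z \<and> Z \<noteq> {} \<and>
    (\<forall>A B. closedin T A \<and> closedin T B \<and> Z = A \<union> B \<longrightarrow> Z = A \<or> Z = B)"

definition krull_dim :: "'a topology \<Rightarrow> 'a set \<Rightarrow> enat"
  where "krull_dim T X = Sup {enat k |k. \<exists>C.
    (\<forall>i\<le>k. irreducible_closed T (C i) \<and> C i \<subseteq> X) \<and> (\<forall>i<k. C i \<subset> C (Suc i))}"

text \<open>A closed subvariety of \<open>\<P>\<^sup>n\<close> over \<open>\<rat>\<close> (integral, hence reduced), given by its set of complex
  points.\<close>

definition proj_variety :: "nat \<Rightarrow> ppoint set \<Rightarrow> bool"
  where "proj_variety n X \<longleftrightarrow> irreducible_closed (zariski n) X"

definition vanishing_forms :: "nat \<Rightarrow> ppoint set \<Rightarrow> cpoly set"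
  where "vanishing_forms n X = {g \<in> (\<Union>d. forms \<rat> n d). \<forall>x\<in>X. \<forall>v\<in>x. peval g v = 0}"

text \<open>Rank of the Jacobian matrix at \<open>v\<close> of (generators of) the homogeneous ideal of \<open>X\<close>.\<close>

definition jacobian_rank :: "nat \<Rightarrow> ppoint set \<Rightarrow> (nat \<Rightarrow> complex) \<Rightarrow> nat"
  where "jacobian_rank n X v =
    vector_space.dim (\<lambda>c w i. c * w i) ((\<lambda>g. gradient g v) ` vanishing_forms n X)"

text \<open>Smoothness over \<open>\<rat>\<close>: the Jacobian matrix has rank \<open>n - dim X\<close> at all geometric points.\<close>

definition smooth_variety :: "nat \<Rightarrow> ppoint set \<Rightarrow> bool"
  where "smooth_variety n X \<longleftrightarrow> (\<forall>x\<in>X. \<forall>v\<in>x.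
    enat (jacobian_rank n X v) + krull_dim (zariski n) X = enat n)"

lemma vector_space_complex_fun:
  "vector_space (\<lambda>(c::complex) (w::nat \<Rightarrow> complex) i. c * w i)"
  by unfold_locales (auto simp: algebra_simps)

definition zariski_dense :: "nat \<Rightarrow> ppoint set \<Rightarrow> ppoint set \<Rightarrow> bool"
  where "zariski_dense n X S \<longleftrightarrow> S \<subseteq> X \<and> X \<subseteq> zariski n closure_of S"

section \<open>Rational maps and unirationality\<close>

text \<open>The image of the rational map \<open>(f\<^sub>0 : \<dots> : f\<^sub>n)\<close> on \<open>\<P>\<^sup>m\<close>, taken over the points at which
  the \<open>f\<^sub>i\<close> do not all vanish.\<close>

definition rational_image :: "nat \<Rightarrow> nat \<Rightarrow> (nat \<Rightarrow> cpoly) \<Rightarrow> ppoint set"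
  where "rational_image m n f =
    {proj_point (\<lambda>i. if i \<le> n then peval (f i) v else 0) |v.
       v \<in> vectors m \<and> (\<exists>i\<le>n. peval (f i) v \<noteq> 0)}"

text \<open>\<open>(f\<^sub>0 : \<dots> : f\<^sub>n)\<close> is a dominant rational map from \<open>\<P>\<^sup>m\<close> to \<open>X\<close>, the \<open>f\<^sub>i\<close> being forms of the
  same degree \<open>d\<close> with coefficients in \<open>R\<close>.\<close>

definition dominant_map ::
  "complex set \<Rightarrow> nat \<Rightarrow> nat \<Rightarrow> nat \<Rightarrow> (nat \<Rightarrow> cpoly) \<Rightarrow> ppoint set \<Rightarrow> bool"
  where "dominant_map R m n d f X \<longleftrightarrow>
    (\<forall>i\<le>n. f i \<in> forms R m d) \<and> zariski_dense n X (rational_image m n f)"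

definition unirational :: "nat \<Rightarrow> ppoint set \<Rightarrow> bool"
  where "unirational n X \<longleftrightarrow> (\<exists>m\<ge>1. \<exists>d f. dominant_map \<rat> m n d f X)"

section \<open>The saturation number\<close>

definition big_Omega :: "int \<Rightarrow> enat"
  where "big_Omega k =
    (if k = 0 then \<infinity> else enat (\<Sum>p\<in>prime_factors k. multiplicity p k))"

definition primitive_coords :: "nat \<Rightarrow> ppoint \<Rightarrow> (nat \<Rightarrow> int) \<Rightarrow> bool"
  where "primitive_coords n x a \<longleftrightarrow>
    Gcd (a ` {..n}) = 1 \<and> x = proj_point (\<lambda>i. if i \<le> n then of_int (a i) else 0)"

definition rational_points :: "nat \<Rightarrow> ppoint set"
  where "rational_points n = {proj_point v |v. v \<in> vectors n \<and> range v \<subseteq> \<rat>}"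

definition proj_Omega :: "nat \<Rightarrow> ppoint \<Rightarrow> enat"
  where "proj_Omega n x =
    (THE r. \<exists>a. primitive_coords n x a \<and> r = big_Omega (\<Prod>i\<le>n. a i))"

text \<open>Defined by an infimum, so that it is \<open>\<infinity>\<close> also when \<open>X(\<rat>)\<close> itself is not dense; since
  \<^typ>\<open>enat\<close> is well-ordered, the infimum is otherwise the least element.\<close>

definition saturation_number :: "nat \<Rightarrow> ppoint set \<Rightarrow> enat"
  where "saturation_number n X =
    Inf {r. zariski_dense n X {x \<in> X \<inter> rational_points n. proj_Omega n x \<le> r}}"

lemma primitive_coords_exist:
  assumes "x \<in> rational_points n"
  shows "\<exists>a. primitive_coords n x a"
proof -
  obtain v where v: "v \<in> vectors n" "range v \<subseteq> \<rat>" and x: "x = proj_point v"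
    using assms by (auto simp: rational_points_def)
  have "\<exists>p q. q \<noteq> 0 \<and> v i = of_int p / of_int q" for i
  proof -
    have "v i \<in> \<rat>" using v(2) by blast
    then show ?thesis by (metis Rats_cases' less_irrefl)
  qed
  then obtain p q :: "nat \<Rightarrow> int" where q: "\<And>i. q i \<noteq> 0"
    and pq: "\<And>i. v i = of_int (p i) / of_int (q i)"
    by metis
  define N where "N = (\<Prod>i\<le>n. q i)"
  have N0: "N \<noteq> 0" using q by (simp add: N_def)
  define b where "b i = p i * (N div q i)" for i
  have b: "of_int (b i) = of_int N * v i" if "i \<le> n" for i
  proof -
    have "q i dvd N" unfolding N_def using that by (intro dvd_prodI) auto
    then have "N = q i * (N div q i)" by simp
    then have "(of_int N :: complex) = of_int (q i) * of_int (N div q i)"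
      by (metis of_int_mult)
    then show ?thesis using q[of i] by (simp add: pq b_def)
  qed
  define g where "g = Gcd (b ` {..n})"
  have g0: "g \<noteq> 0"
  proof
    assume "g = 0"
    then have "b i = 0" if "i \<le> n" for i
      using that by (auto simp: g_def)
    then have "v i = 0" if "i \<le> n" for i
      using b[OF that] that N0 by simp
    then show False using v(1) by (auto simp: vectors_def)
  qed
  define a where "a i = b i div g" for i
  have ga: "b i = g * a i" if "i \<le> n" for i
    using that by (simp add: a_def g_def)
  have "g = Gcd ((\<lambda>i. g * a i) ` {..n})"
    unfolding g_def using ga by (intro arg_cong[of _ _ Gcd] image_cong) (auto simp: g_def)
  also have "\<dots> = normalize (g * Gcd (a ` {..n}))"
    using Gcd_mult[of g "a ` {..n}"] by (simp add: image_image)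
  also have "\<dots> = g * Gcd (a ` {..n})"
    by (simp add: normalize_mult g_def)
  finally have "Gcd (a ` {..n}) = 1" using g0 by simp
  moreover have "x = proj_point (\<lambda>i. if i \<le> n then of_int (a i) else 0)"
  proof -
    define c where "c = (of_int N / of_int g :: complex)"
    have c0: "c \<noteq> 0" using N0 g0 by (simp add: c_def)
    have "(\<lambda>i. if i \<le> n then of_int (a i) else 0) = (\<lambda>i. c * v i)"
    proof
      fix i
      show "(if i \<le> n then of_int (a i) else 0) = c * v i"
      proof (cases "i \<le> n")
        case True
        have "of_int g * of_int (a i) = of_int N * v i"
          using b[OF True] ga[OF True] by simp
        then show ?thesis using True g0 by (simp add: c_def field_simps)
      next
        case False
        then show ?thesis using v(1) by (simp add: vectors_def)
      qed
    qed
    then show ?thesis unfolding x using proj_point_scale[OF c0, of v] by simp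
  qed
  ultimately show ?thesis unfolding primitive_coords_def by blast
qed

lemma proj_Omega_eq:
  assumes a: "primitive_coords n x a"
  shows "proj_Omega n x = big_Omega (\<Prod>i\<le>n. a i)"
proof -
  have uniq: "big_Omega (\<Prod>i\<le>n. b i) = big_Omega (\<Prod>i\<le>n. a i)" if b: "primitive_coords n x b" for b
  proof -
    let ?v = "\<lambda>a i. if i \<le> n then of_int (a i) else (0::complex)"
    have "?v b \<in> proj_point (?v a)"
    proof -
      have "proj_point (?v a) = proj_point (?v b)"
        using a b by (metis primitive_coords_def)
      then show ?thesis using proj_point_self[of "?v b"] by (simp only:)
    qed
    then obtain c where "?v b = (\<lambda>i. c * ?v a i)"
      by (auto simp: proj_point_def)
    then have c: "of_int (b i) = c * (of_int (a i) :: complex)" if "i \<le> n" for i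
      using fun_cong[of "?v b" "\<lambda>i. c * ?v a i" i] that by simp
    have cross: "b i * a j = b j * a i" if "i \<le> n" "j \<le> n" for i j
    proof -
      have "(of_int (b i * a j) :: complex) = of_int (b j * a i)"
        using c[OF that(1)] c[OF that(2)] by simp
      then show ?thesis by (simp only: of_int_eq_iff)
    qed
    have gcds: "Gcd (a ` {..n}) = 1" "Gcd (b ` {..n}) = 1"
      by (rule a[unfolded primitive_coords_def, THEN conjunct1]
               b[unfolded primitive_coords_def, THEN conjunct1])+
    have dvd: "a j dvd b j \<and> b j dvd a j" if j: "j \<le> n" for j
    proof
      have "a j dvd Gcd ((\<lambda>i. b j * a i) ` {..n})"
      proof (rule Gcd_greatest)
        fix k assume "k \<in> (\<lambda>i. b j * a i) ` {..n}"
        then obtain i where "i \<le> n" "k = b j * a i" by auto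
        then have "k = b i * a j" using cross[of i j] j by simp
        then show "a j dvd k" by simp
      qed
      also have "Gcd ((\<lambda>i. b j * a i) ` {..n}) = normalize (b j * Gcd (a ` {..n}))"
        using Gcd_mult[of "b j" "a ` {..n}"] by (simp add: image_image)
      finally show "a j dvd b j" using gcds by simp
      have "b j dvd Gcd ((\<lambda>i. a j * b i) ` {..n})"
      proof (rule Gcd_greatest)
        fix k assume "k \<in> (\<lambda>i. a j * b i) ` {..n}"
        then obtain i where "i \<le> n" "k = a j * b i" by auto
        then have "k = b j * a i" using cross[of i j] j by (simp add: mult.commute)
        then show "b j dvd k" by simp
      qed
      also have "Gcd ((\<lambda>i. a j * b i) ` {..n}) = normalize (a j * Gcd (b ` {..n}))"
        using Gcd_mult[of "a j" "b ` {..n}"] by (simp add: image_image)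
      finally show "b j dvd a j" using gcds by simp
    qed
    have "normalize (\<Prod>i\<le>n. b i) = normalize (\<Prod>i\<le>n. a i)"
      by (intro associatedI prod_dvd_prod) (use dvd in auto)
    then have eq: "\<bar>\<Prod>i\<le>n. b i\<bar> = \<bar>\<Prod>i\<le>n. a i\<bar>" by simp
    have "big_Omega k = big_Omega \<bar>k\<bar>" for k
    proof -
      have "prime_factors \<bar>k\<bar> = prime_factors k"
        by (metis normalize_int_def prime_factorization_normalize)
      moreover have "multiplicity p \<bar>k\<bar> = multiplicity p k" for p
        by (metis normalize_int_def multiplicity_normalize_right)
      ultimately show ?thesis by (simp add: big_Omega_def)
    qed
    then show ?thesis using eq by metis
  qed
  then show ?thesis
    unfolding proj_Omega_def using a by (intro the_equality) blast+
qed

end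

(* Restrict F to a line u + t Q b through an integral point u at which F(u) is nonzero and bounded in
   terms of deg F and the coefficients only.  If Q = F(u) w! with w large in terms of deg F, then
   F(u + t Q b) = F(u) G(t) with an integral polynomial G congruent to 1 modulo w!, which has
   at most deg F roots modulo every prime and none modulo the primes up to w.  The Brun-Hooley
   sieve therefore gives arbitrarily large t such that G(t) has no prime factor below a fixed power of t,
   hence O((deg F)^2) prime factors.  The direction b can be chosen so that the line is not
   contained in a given hypersurface, which yields Zariski density in the source of the dominant
   map and hence in X. *)

theory Submission
  imports Defs "HOL-Number_Theory.Cong"
begin

section \<open>Truncated inclusion-exclusion and the Brun-Hooley inequality\<close>

text \<open>The direction \<open>b\<close> depends on the hypersurface to be avoided, so the
  coefficients of \<open>G\<close> are beyond control. This does no harm because the sieving limit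
  can be raised at will: it is taken larger than the growth constant of \<open>G\<close>, which then
  costs no prime factor. The coefficients of F enter only through the fixed factor F(u). It has at
  most log2 |F(u)| prime factors, and this is the source of the logarithm in the bound. Modulo p the
  polynomial \<open>G\<close> can have as many as D roots, so the proportion of t lost at p can be
  D/p. The sieve wants it to be at most 1/2, so the primes up to 2 D have to be disposed of
  beforehand. The choice w = 2^(2^D) does so, and it is at the same time a convenient start for
  blocks of primes whose endpoints arise by repeated squaring.\<close>

definition alternating_sum :: "nat set \<Rightarrow> nat \<Rightarrow> (nat \<Rightarrow> real) \<Rightarrow> real"
  where "alternating_sum P k h = (\<Sum>B\<in>{B. B \<subseteq> P \<and> card B < k}. (- 1) ^ card B * prod h B)"

definition symmetric_sum :: "nat set \<Rightarrow> nat \<Rightarrow> (nat \<Rightarrow> real) \<Rightarrow> real"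
  where "symmetric_sum P k h = (\<Sum>B\<in>{B. B \<subseteq> P \<and> card B = k}. prod h B)"

lemma finite_subsets_card [simp]: "finite P \<Longrightarrow> finite {B. B \<subseteq> P \<and> Q B}"
  by (rule finite_subset[of _ "Pow P"]) auto

lemma alternating_sum_0 [simp]: "alternating_sum P 0 h = 0"
  by (simp add: alternating_sum_def)

lemma alternating_sum_Suc:
  assumes "finite P"
  shows "alternating_sum P (Suc k) h = alternating_sum P k h + (- 1) ^ k * symmetric_sum P k h"
proof -
  have "{B. B \<subseteq> P \<and> card B < Suc k} = {B. B \<subseteq> P \<and> card B < k} \<union> {B. B \<subseteq> P \<and> card B = k}"
    by auto
  then have "alternating_sum P (Suc k) h = alternating_sum P k h
      + (\<Sum>B\<in>{B. B \<subseteq> P \<and> card B = k}. (- 1) ^ card B * prod h B)"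
    unfolding alternating_sum_def using assms by (simp only:) (subst sum.union_disjoint, auto)
  also have "(\<Sum>B\<in>{B. B \<subseteq> P \<and> card B = k}. (- 1) ^ card B * prod h B)
      = (- 1) ^ k * symmetric_sum P k h"
    unfolding symmetric_sum_def sum_distrib_left by (intro sum.cong) auto
  finally show ?thesis .
qed

text \<open>Subsets of \<open>insert q P\<close> either avoid \<open>q\<close> or arise from a
  subset of \<open>P\<close> by adding it. The latter have one element more, which lowers the
  truncation order by one and flips the sign.\<close>

lemma alternating_sum_insert:
  assumes "finite P" "q \<notin> P"
  shows "alternating_sum (insert q P) (Suc k) h
    = alternating_sum P (Suc k) h - h q * alternating_sum P k h"
proof -
  have fin: "finite B" if "B \<subseteq> P" for B using that assms(1) finite_subset by blast
  have eq: "{B. B \<subseteq> insert q P \<and> card B < Suc k} =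
     {B. B \<subseteq> P \<and> card B < Suc k} \<union> insert q ` {B. B \<subseteq> P \<and> card B < k}" (is "?L = ?A \<union> ?R")
  proof (intro equalityI subsetI)
    fix B assume B: "B \<in> ?L"
    show "B \<in> ?A \<union> ?R"
    proof (cases "q \<in> B")
      case True
      then obtain C where C: "B = insert q C" "q \<notin> C" by (meson mk_disjoint_insert)
      then have "C \<subseteq> P" using B by auto
      then show ?thesis using B C fin[of C] by (auto simp: card_insert_if)
    qed (use B in auto)
  next
    fix B assume "B \<in> ?A \<union> ?R"
    then show "B \<in> ?L" using assms(2) fin by (auto simp: card_insert_if)
  qed
  have "alternating_sum (insert q P) (Suc k) h = alternating_sum P (Suc k) h
      + (\<Sum>B\<in>?R. (- 1) ^ card B * prod h B)"
    unfolding alternating_sum_def eq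
    using assms by (subst sum.union_disjoint) auto
  also have "(\<Sum>B\<in>?R. (- 1) ^ card B * prod h B)
     = (\<Sum>B\<in>{B. B \<subseteq> P \<and> card B < k}. (- 1) ^ card (insert q B) * prod h (insert q B))"
    by (subst sum.reindex) (use assms(2) in \<open>auto simp: inj_on_def insert_ident\<close>)
  also have "\<dots> = - h q * alternating_sum P k h"
    unfolding alternating_sum_def sum_distrib_left
  proof (intro sum.cong refl)
    fix B assume "B \<in> {B. B \<subseteq> P \<and> card B < k}"
    then have "finite B" "q \<notin> B" using assms fin by auto
    then show "(- 1) ^ card (insert q B) * prod h (insert q B) = - h q * ((- 1) ^ card B * prod h B)"
      by simp
  qed
  finally show ?thesis by simp
qed

text \<open>The factor \<open>(- 1) ^ k\<close> puts both parities into one induction, as inserting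
  \<open>q\<close> couples consecutive orders: the signed error becomes that of \<open>P\<close> at
  order \<open>k\<close> plus \<open>h q\<close> times that of \<open>P\<close> at order
  \<open>k - 1\<close>. Real weights in [0, 1] cover both later uses, indicators and
  densities.\<close>

lemma bonferroni_sign:
  assumes "finite P" "\<And>p. p \<in> P \<Longrightarrow> 0 \<le> h p \<and> h p \<le> 1"
  shows "0 \<le> (- 1) ^ k * ((\<Prod>p\<in>P. 1 - h p) - alternating_sum P k h)"
  using assms
proof (induction P arbitrary: k rule: finite_induct)
  case empty
  have "{B. B = ({}::nat set) \<and> card B < k} = (if k = 0 then {} else {{}})" by auto
  then show ?case by (simp add: alternating_sum_def)
next
  case (insert q P)
  show ?case
  proof (cases k)
    case 0
    then show ?thesis using insert by (auto intro!: mult_nonneg_nonneg prod_nonneg)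
  next
    case (Suc l)
    let ?V = "\<Prod>p\<in>P. 1 - h p"
    have "(- 1) ^ k * ((\<Prod>p\<in>insert q P. 1 - h p) - alternating_sum (insert q P) k h)
       = (- 1) ^ k * (?V - alternating_sum P k h) + h q * ((- 1) ^ l * (?V - alternating_sum P l h))"
      using insert(1,2) by (simp add: Suc alternating_sum_insert algebra_simps)
    also have "\<dots> \<ge> 0"
      using insert.IH[of k] insert.IH[of l] insert.prems
      by (intro add_nonneg_nonneg mult_nonneg_nonneg[of "h q"]) auto
    finally show ?thesis .
  qed
qed

text \<open>The truncation keeps sizes below \<open>k\<close>, so an odd \<open>k\<close> ends on an
  even size and overcounts. The truncation at \<open>Suc k\<close> undercounts and differs from it
  by exactly the symmetric sum.\<close>

lemma bonferroni:
  assumes "finite P" "\<And>p. p \<in> P \<Longrightarrow> 0 \<le> h p \<and> h p \<le> 1" "odd k"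
  shows "(\<Prod>p\<in>P. 1 - h p) \<le> alternating_sum P k h"
    and "alternating_sum P k h \<le> (\<Prod>p\<in>P. 1 - h p) + symmetric_sum P k h"
  using bonferroni_sign[of P h k] bonferroni_sign[of P h "Suc k"] assms
  by (auto simp: alternating_sum_Suc)

lemma symmetric_sum_nonneg:
  assumes "\<And>p. p \<in> P \<Longrightarrow> 0 \<le> h p"
  shows "0 \<le> symmetric_sum P k h"
  unfolding symmetric_sum_def using assms by (intro sum_nonneg prod_nonneg) auto

text \<open>The lower bound sieve of Brun and Hooley: \<open>\<Prod>x\<^sub>j \<ge> \<Prod>y\<^sub>j - \<Sum>\<^sub>l u\<^sub>l \<Prod>\<^sub>j\<^sub>\<noteq>\<^sub>l y\<^sub>j\<close> whenever
  \<open>0 \<le> x\<^sub>j \<le> y\<^sub>j \<le> x\<^sub>j + u\<^sub>j\<close> and \<open>x\<^sub>j \<in> {0, 1}\<close>.\<close>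

fun hooley_sum :: "(nat \<Rightarrow> nat set) \<Rightarrow> (nat \<Rightarrow> nat) \<Rightarrow> nat \<Rightarrow> (nat \<Rightarrow> real) \<Rightarrow> real"
  where "hooley_sum P k 0 h = 1"
  | "hooley_sum P k (Suc J) h = alternating_sum (P J) (k J) h * hooley_sum P k J h
       - symmetric_sum (P J) (k J) h * (\<Prod>j<J. alternating_sum (P j) (k j) h)"

text \<open>\<open>hooley_sum\<close> may be negative, so the factors cannot simply be compared. The
  second bound is carried along for the step: the excess of the truncated sum over the true block
  product is nonnegative and at most the symmetric sum, and times the second bound it is cancelled
  by the subtracted term. What remains is the true block product, 0 or 1, times the previous
  \<open>hooley_sum\<close>.\<close>

lemma hooley_sum_le:
  assumes fin: "\<And>j. finite (P j)" and k: "\<And>j. odd (k j)"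
    and h: "\<And>p. h p = 0 \<or> h p = 1"
  shows "hooley_sum P k J h \<le> (\<Prod>j<J. \<Prod>p\<in>P j. 1 - h p) \<and>
    hooley_sum P k J h \<le> (\<Prod>j<J. alternating_sum (P j) (k j) h)"
proof (induction J)
  case (Suc J)
  let ?Y = "\<lambda>j. alternating_sum (P j) (k j) h" and ?X = "\<lambda>j. \<Prod>p\<in>P j. 1 - h p"
    and ?U = "symmetric_sum (P J) (k J) h"
  have h01: "0 \<le> h p \<and> h p \<le> 1" for p using h[of p] by auto
  have X01: "?X j = 0 \<or> ?X j = 1" for j
  proof (cases "\<exists>p\<in>P j. h p = 1")
    case True then show ?thesis using fin by (auto intro!: prod_zero)
  next
    case False then have "h p = 0" if "p \<in> P j" for p using h[of p] that by auto
    then show ?thesis by simp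
  qed
  have XY: "?X j \<le> ?Y j" "?Y j \<le> ?X j + symmetric_sum (P j) (k j) h" for j
    using bonferroni[of "P j" h "k j"] fin k h01 by auto
  have Y0: "0 \<le> ?Y j" for j using XY(1)[of j] X01[of j] by linarith
  have U0: "0 \<le> ?U" using symmetric_sum_nonneg h01 by blast
  have PY0: "0 \<le> (\<Prod>j<J. ?Y j)" using Y0 by (intro prod_nonneg) auto
  have UP: "0 \<le> ?U * (\<Prod>j<J. ?Y j)" using U0 PY0 by simp
  have "?Y J * hooley_sum P k J h \<le> ?Y J * (\<Prod>j<J. ?Y j)"
    using Suc Y0 by (intro mult_left_mono) auto
  then have 1: "hooley_sum P k (Suc J) h \<le> (\<Prod>j<Suc J. ?Y j)"
    using UP by (simp add: mult.commute)
  have 2: "hooley_sum P k (Suc J) h \<le> (\<Prod>j<Suc J. ?X j)"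
  proof -
    have c: "?X J = 0 \<or> ?X J = 1" by (rule X01)
    have "(?Y J - ?X J) * hooley_sum P k J h \<le> (?Y J - ?X J) * (\<Prod>j<J. ?Y j)"
      using Suc XY(1)[of J] by (intro mult_left_mono) auto
    also have "\<dots> \<le> ?U * (\<Prod>j<J. ?Y j)"
      using XY(2)[of J] PY0 by (intro mult_right_mono) auto
    finally have "hooley_sum P k (Suc J) h \<le> ?X J * hooley_sum P k J h"
      by (simp add: algebra_simps)
    also have "\<dots> \<le> (\<Prod>j<Suc J. ?X j)"
      using c Suc by (auto simp: mult.commute)
    finally show ?thesis .
  qed
  show ?case using 1 2 by blast
qed simp

text \<open>For weights below 1, such as local densities, every block product is positive and at
  most the truncated sum. The term subtracted at block \<open>J\<close> is therefore at most the
  quotient of the symmetric sum by the block product, times the full product of truncated sums; only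
  these relative errors add up.\<close>

lemma hooley_sum_ge:
  assumes fin: "\<And>j. finite (P j)" and k: "\<And>j. odd (k j)"
    and h: "\<And>p. 0 \<le> h p \<and> h p < 1"
  shows "(\<Prod>j<J. alternating_sum (P j) (k j) h) *
      (1 - (\<Sum>j<J. symmetric_sum (P j) (k j) h / (\<Prod>p\<in>P j. 1 - h p))) \<le> hooley_sum P k J h"
proof (induction J)
  case (Suc J)
  let ?Y = "\<lambda>j. alternating_sum (P j) (k j) h" and ?X = "\<lambda>j. \<Prod>p\<in>P j. 1 - h p"
    and ?U = "\<lambda>j. symmetric_sum (P j) (k j) h"
  have X0: "0 < ?X j" for j using h by (intro prod_pos) auto
  have XY: "?X j \<le> ?Y j" for j
    using bonferroni(1)[of "P j" h "k j"] fin k h less_imp_le by blast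
  have Y0: "0 \<le> ?Y j" for j using X0[of j] XY[of j] by linarith
  have PY0: "0 \<le> (\<Prod>j<J. ?Y j)" using Y0 by (intro prod_nonneg) auto
  have U0: "0 \<le> ?U j" for j using symmetric_sum_nonneg h by blast
  have "?U J = ?U J / ?X J * ?X J" using X0[of J] by simp
  also have "\<dots> \<le> ?U J / ?X J * ?Y J"
    using U0 X0[of J] XY by (intro mult_left_mono) auto
  finally have "?U J * (\<Prod>j<J. ?Y j) \<le> ?U J / ?X J * ?Y J * (\<Prod>j<J. ?Y j)"
    using PY0 by (intro mult_right_mono)
  moreover have "?Y J * ((\<Prod>j<J. ?Y j) * (1 - (\<Sum>j<J. ?U j / ?X j))) \<le> ?Y J * hooley_sum P k J h"
    using Suc Y0 by (intro mult_left_mono) auto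
  ultimately show ?case by (simp add: algebra_simps)
qed simp

section \<open>Expansion of the sieve into a sum over sets of primes\<close>

definition sieve_support :: "(nat \<Rightarrow> nat set) \<Rightarrow> (nat \<Rightarrow> nat) \<Rightarrow> nat \<Rightarrow> nat set set"
  where "sieve_support P k J = {B. B \<subseteq> (\<Union>j<J. P j) \<and> (\<forall>j<J. card (B \<inter> P j) \<le> k j)}"

text \<open>A set in the support splits uniquely into its part in the top block and the rest. With
  two arbitrary functions, the same splitting serves for the coefficients of the sieve and for the
  sum of its error terms.\<close>

lemma sum_sieve_support_Suc:
  fixes \<phi> \<psi> :: "nat set \<Rightarrow> real"
  assumes fin: "\<And>j. finite (P j)" and disj: "disjoint_family P"
  shows "(\<Sum>C\<in>sieve_support P k (Suc J). \<phi> (C \<inter> P J) * \<psi> (C - P J))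
    = (\<Sum>B\<in>{B. B \<subseteq> P J \<and> card B \<le> k J}. \<phi> B) * (\<Sum>B\<in>sieve_support P k J. \<psi> B)"
proof -
  have d: "P i \<inter> P j = {}" if "i \<noteq> j" for i j
    using disj that by (auto simp: disjoint_family_on_def)
  have dJ: "P J \<inter> P j = {}" if "j < J" for j using d that by auto
  let ?S = "{B. B \<subseteq> P J \<and> card B \<le> k J} \<times> sieve_support P k J"
  have "(\<Sum>C\<in>sieve_support P k (Suc J). \<phi> (C \<inter> P J) * \<psi> (C - P J))
     = (\<Sum>(B, B')\<in>?S. \<phi> B * \<psi> B')"
  proof (rule sum.reindex_bij_witness[where i = "\<lambda>(B, B'). B \<union> B'" and j = "\<lambda>C. (C \<inter> P J, C - P J)"])
    fix C assume C: "C \<in> sieve_support P k (Suc J)"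
    have "(C - P J) \<inter> P j = C \<inter> P j" if "j < J" for j using dJ[OF that] by blast
    moreover have "C - P J \<subseteq> (\<Union>j<J. P j)" using C by (auto simp: sieve_support_def lessThan_Suc)
    ultimately show "(C \<inter> P J, C - P J) \<in> ?S" using C by (auto simp: sieve_support_def)
    show "(\<lambda>(B, B'). B \<union> B') (C \<inter> P J, C - P J) = C" by auto
    show "(case (C \<inter> P J, C - P J) of (B, B') \<Rightarrow> \<phi> B * \<psi> B') = \<phi> (C \<inter> P J) * \<psi> (C - P J)" by simp
  next
    fix BB assume "BB \<in> ?S"
    then obtain B B' where BB: "BB = (B, B')" "B \<subseteq> P J" "card B \<le> k J" "B' \<in> sieve_support P k J"
      by auto
    have e: "B' \<inter> P J = {}" using BB(4) dJ by (fastforce simp: sieve_support_def)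
    have 1: "(B \<union> B') \<inter> P J = B" "(B \<union> B') - P J = B'" using e BB(2) by blast+
    show "(\<lambda>C. (C \<inter> P J, C - P J)) ((\<lambda>(B, B'). B \<union> B') BB) = BB" using 1 BB(1) by simp
    have "(B \<union> B') \<inter> P j = B' \<inter> P j" if "j < J" for j using dJ[OF that] BB(2) by blast
    moreover have "B \<union> B' \<subseteq> (\<Union>j<Suc J. P j)"
      using BB by (auto simp: sieve_support_def lessThan_Suc)
    ultimately show "(\<lambda>(B, B'). B \<union> B') BB \<in> sieve_support P k (Suc J)"
      using BB 1(1) by (auto simp: sieve_support_def less_Suc_eq)
  qed
  then show ?thesis by (simp add: sum_product sum.cartesian_product)
qed

lemma prod_split_block:
  fixes h :: "nat \<Rightarrow> 'a::comm_monoid_mult"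
  assumes "finite C"
  shows "prod h C = prod h (C \<inter> Q) * prod h (C - Q)"
  using assms by (subst prod.union_disjoint[symmetric]) (auto intro!: prod.cong)

lemma finite_in_support:
  "(\<And>j. finite (P j)) \<Longrightarrow> C \<in> sieve_support P k J \<Longrightarrow> finite C"
  unfolding sieve_support_def by (auto intro: finite_subset)

text \<open>The coefficients do not depend on \<open>h\<close>; this allows the sieve at the
  indicators of single values and the sieve at their densities to be compared term by term. They
  stay within [-1, 1] because in the top block the truncated sum uses sizes below \<open>k J\<close>
  and the symmetric sum the size \<open>k J\<close> only, so for each set just one of the two terms
  survives.\<close>

lemma sieve_expansion:
  assumes fin: "\<And>j. finite (P j)" and disj: "disjoint_family P"
  shows "\<exists>c. (\<forall>C. \<bar>c C\<bar> \<le> 1) \<and>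
      (\<forall>h. hooley_sum P k J h = (\<Sum>C\<in>sieve_support P k J. c C * prod h C))"
proof -
  have alt: "alternating_sum (P J) (k J) h =
      (\<Sum>B\<in>{B. B \<subseteq> P J \<and> card B \<le> k J}. (if card B < k J then (- 1) ^ card B else 0) * prod h B)" for J h
    unfolding alternating_sum_def by (intro sum.mono_neutral_cong_left) (use fin in auto)
  have sym: "symmetric_sum (P J) (k J) h =
      (\<Sum>B\<in>{B. B \<subseteq> P J \<and> card B \<le> k J}. (if card B < k J then 0 else 1) * prod h B)" for J h
    unfolding symmetric_sum_def by (intro sum.mono_neutral_cong_left) (use fin in auto)
  have step: "(\<Sum>B\<in>{B. B \<subseteq> P J \<and> card B \<le> k J}. e B * prod h B) * (\<Sum>C\<in>sieve_support P k J. c C * prod h C)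
      = (\<Sum>C\<in>sieve_support P k (Suc J). e (C \<inter> P J) * c (C - P J) * prod h C)"
    for J h and e c :: "nat set \<Rightarrow> real"
    unfolding sum_sieve_support_Suc[where P = P and \<phi> = "\<lambda>B. e B * prod h B"
      and \<psi> = "\<lambda>C. c C * prod h C" and J = J and k = k, OF fin disj, symmetric]
  proof (rule sum.cong[OF refl])
    fix C assume "C \<in> sieve_support P k (Suc J)"
    then have "prod h C = prod h (C \<inter> P J) * prod h (C - P J)"
      using prod_split_block finite_in_support[of P] fin by blast
    then show "e (C \<inter> P J) * prod h (C \<inter> P J) * (c (C - P J) * prod h (C - P J)) =
       e (C \<inter> P J) * c (C - P J) * prod h C" by simp
  qed
  \<comment> \<open>The recursion for \<open>hooley_sum\<close> involves the product of truncated
    sums too, so the coefficients \<open>c\<close> of that product go through the induction together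
    with \<open>b\<close>.\<close>
  have "\<exists>c b. (\<forall>C. \<bar>c C\<bar> \<le> 1) \<and> (\<forall>C. \<bar>b C\<bar> \<le> 1) \<and>
      (\<forall>h. (\<Prod>j<J. alternating_sum (P j) (k j) h) = (\<Sum>C\<in>sieve_support P k J. c C * prod h C)) \<and>
      (\<forall>h. hooley_sum P k J h = (\<Sum>C\<in>sieve_support P k J. b C * prod h C))"
  proof (induction J)
    case 0
    have "sieve_support P k 0 = {{}}" by (auto simp: sieve_support_def)
    then show ?case by (intro exI[of _ "\<lambda>_. 1"]) simp
  next
    case (Suc J)
    then obtain c b where c: "\<And>C. \<bar>c C\<bar> \<le> 1" "\<And>C. \<bar>b C\<bar> \<le> 1"
      and e: "\<And>h. (\<Prod>j<J. alternating_sum (P j) (k j) h) = (\<Sum>C\<in>sieve_support P k J. c C * prod h C)"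
       "\<And>h. hooley_sum P k J h = (\<Sum>C\<in>sieve_support P k J. b C * prod h C)" by blast
    let ?s = "\<lambda>C. if card (C \<inter> P J) < k J then (- 1) ^ card (C \<inter> P J) else (0::real)"
    let ?u = "\<lambda>C. if card (C \<inter> P J) < k J then 0 else (1::real)"
    have "(\<Prod>j<Suc J. alternating_sum (P j) (k j) h) =
        (\<Sum>C\<in>sieve_support P k (Suc J). ?s C * c (C - P J) * prod h C)" for h
      by (subst prod.lessThan_Suc, subst mult.commute, simp only: e) (simp only: alt step)
    moreover have "hooley_sum P k (Suc J) h =
        (\<Sum>C\<in>sieve_support P k (Suc J). (?s C * b (C - P J) - ?u C * c (C - P J)) * prod h C)" for h
      by (simp only: hooley_sum.simps e)
         (simp only: alt sym step left_diff_distrib sum_subtractf)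
    moreover have "\<bar>?s C * c (C - P J)\<bar> \<le> 1" "\<bar>?s C * b (C - P J) - ?u C * c (C - P J)\<bar> \<le> 1" for C
      using c[of "C - P J"] by (auto simp: abs_mult)
    ultimately show ?case by (intro exI[of _ "\<lambda>C. ?s C * c (C - P J)"]
        exI[of _ "\<lambda>C. ?s C * b (C - P J) - ?u C * c (C - P J)"]) blast
  qed
  then show ?thesis by blast
qed

text \<open>With a constant weight, this factors the total error of the sieve over the
  blocks.\<close>

lemma sum_sieve_support:
  fixes h :: "nat \<Rightarrow> real"
  assumes fin: "\<And>j. finite (P j)" and disj: "disjoint_family P"
  shows "(\<Sum>C\<in>sieve_support P k J. prod h C) = (\<Prod>j<J. \<Sum>B\<in>{B. B \<subseteq> P j \<and> card B \<le> k j}. prod h B)"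
proof (induction J)
  case 0
  have "sieve_support P k 0 = {{}}" by (auto simp: sieve_support_def)
  then show ?case by simp
next
  case (Suc J)
  have "(\<Sum>C\<in>sieve_support P k (Suc J). prod h C)
     = (\<Sum>C\<in>sieve_support P k (Suc J). prod h (C \<inter> P J) * prod h (C - P J))"
    by (rule sum.cong[OF refl]) (use prod_split_block finite_in_support[of P] fin in blast)
  also have "\<dots> = (\<Sum>B\<in>{B. B \<subseteq> P J \<and> card B \<le> k J}. prod h B) * (\<Sum>B\<in>sieve_support P k J. prod h B)"
    by (rule sum_sieve_support_Suc[OF fin disj])
  finally show ?case by (simp only: Suc prod.lessThan_Suc mult.commute)
qed

section \<open>Counting roots of polynomials modulo primes\<close>

lemma periodic_count_interval:
  fixes Q :: "nat \<Rightarrow> bool"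
  assumes per: "\<And>t. Q (t + d) = Q t"
  shows "card {t \<in> {T..<T + d}. Q t} = card {t \<in> {..<d}. Q t}"
proof (induction T)
  case 0
  then show ?case by (simp add: atLeast0LessThan)
next
  case (Suc T)
  show ?case
  proof (cases "d = 0")
    case False
    then have "{T..<T + d} = insert T {Suc T..<T + d}" "{Suc T..<Suc T + d} = insert (T + d) {Suc T..<T + d}"
      by auto
    then have "{t \<in> {T..<T + d}. Q t} = (if Q T then {T} else {}) \<union> {t \<in> {Suc T..<T + d}. Q t}"
      "{t \<in> {Suc T..<Suc T + d}. Q t} = (if Q T then {T + d} else {}) \<union> {t \<in> {Suc T..<T + d}. Q t}"
      using per[of T] by auto
    then have "card {t \<in> {Suc T..<Suc T + d}. Q t} = card {t \<in> {T..<T + d}. Q t}"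
      by (simp only:) (auto simp: card_insert_if)
    then show ?thesis using Suc by simp
  qed simp
qed

lemma card_interval_split:
  fixes Q :: "nat \<Rightarrow> bool"
  assumes "a \<le> b"
  shows "card {t \<in> {a..<b + d}. Q t} = card {t \<in> {a..<b}. Q t} + card {t \<in> {b..<b + d}. Q t}"
proof -
  have eq: "{t \<in> {a..<b + d}. Q t} = {t \<in> {a..<b}. Q t} \<union> {t \<in> {b..<b + d}. Q t}"
    using assms by auto
  show ?thesis unfolding eq by (rule card_Un_disjoint) auto
qed

lemma periodic_count_blocks:
  fixes Q :: "nat \<Rightarrow> bool"
  assumes per: "\<And>t. Q (t + d) = Q t"
  shows "card {t \<in> {T..<T + q * d}. Q t} = q * card {t \<in> {..<d}. Q t}"
proof (induction q)
  case (Suc q)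
  have "T + Suc q * d = T + q * d + d" by simp
  then show ?case
    using Suc card_interval_split[of T "T + q * d" d Q] periodic_count_interval[of Q d "T + q * d", OF per]
    by (simp only: mult_Suc le_add1 add.commute)
qed simp

text \<open>With \<open>q = N div d\<close> complete periods, both the count and its expected value
  lie between \<open>q * r\<close> and \<open>(q + 1) * r\<close>.\<close>

lemma periodic_count:
  fixes Q :: "nat \<Rightarrow> bool" and T N d :: nat
  assumes per: "\<And>t. Q (t + d) = Q t" and "0 < d"
  defines "r \<equiv> card {t \<in> {..<d}. Q t}"
  shows "\<bar>real (card {t \<in> {T..<T + N}. Q t}) - N * (r / d)\<bar> \<le> r"
proof -
  define q where "q = N div d"
  have N: "q * d \<le> N" "N \<le> q * d + d"
    unfolding q_def using dividend_less_div_times[OF \<open>0 < d\<close>, of N] by (simp_all add: add.commute)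
  have "card {t \<in> {T..<T + q * d}. Q t} \<le> card {t \<in> {T..<T + N}. Q t}"
    using N by (intro card_mono) auto
  moreover have "card {t \<in> {T..<T + N}. Q t} \<le> card {t \<in> {T..<T + Suc q * d}. Q t}"
    using N by (intro card_mono) auto
  ultimately have c: "q * r \<le> card {t \<in> {T..<T + N}. Q t}" "card {t \<in> {T..<T + N}. Q t} \<le> Suc q * r"
    unfolding r_def by (simp_all only: periodic_count_blocks[where Q = Q, OF per])
  have "real (q * d) * (r / d) \<le> N * (r / d)" "N * (r / d) \<le> real (q * d + d) * (r / d)"
    using N by (intro mult_right_mono; simp flip: of_nat_mult of_nat_add)+
  then have main: "real (q * r) \<le> N * (r / d)" "N * (r / d) \<le> real (Suc q * r)"
    using \<open>0 < d\<close> by (simp_all add: field_simps)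
  have count: "real (q * r) \<le> card {t \<in> {T..<T + N}. Q t}"
      "real (card {t \<in> {T..<T + N}. Q t}) \<le> real (Suc q * r)"
    using c by (simp_all only: of_nat_le_iff)
  have bound: "\<bar>x - y\<bar> \<le> c" if "a \<le> y" "y \<le> a + c" "a \<le> x" "x \<le> a + c" for x y a c :: real
    using that by linarith
  have "real (Suc q * r) = real (q * r) + r"
    by (simp only: mult_Suc of_nat_add add.commute)
  then show ?thesis
    using bound[OF main(1) _ count(1), of r] main(2) count(2) by (simp only:)
qed

lemma crt_count:
  fixes Q R :: "nat \<Rightarrow> bool"
  assumes "coprime a b" "0 < a" "0 < b"
    and Q: "\<And>t. Q (t mod a) = Q t" and R: "\<And>t. R (t mod b) = R t"
  shows "card {t \<in> {..<a * b}. Q t \<and> R t} = card {t \<in> {..<a}. Q t} * card {t \<in> {..<b}. R t}"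
proof -
  let ?f = "\<lambda>t. (t mod a, t mod b)"
  have "inj_on ?f {..<a * b}"
  proof (rule inj_onI)
    fix x y assume xy: "x \<in> {..<a * b}" "y \<in> {..<a * b}" "?f x = ?f y"
    then have "[x = y] (mod a)" "[x = y] (mod b)" by (auto simp: cong_def)
    then have "[x = y] (mod a * b)" using assms(1) coprime_cong_mult_nat by blast
    then show "x = y" using xy by (simp add: cong_def)
  qed
  moreover have "?f ` {..<a * b} = {..<a} \<times> {..<b}"
  proof (rule card_subset_eq)
    show "card (?f ` {..<a * b}) = card ({..<a} \<times> {..<b})"
      using calculation by (simp add: card_image card_cartesian_product)
  qed (use assms in auto)
  ultimately have f: "bij_betw ?f {..<a * b} ({..<a} \<times> {..<b})" by (simp add: bij_betw_def)
  have "bij_betw ?f {t \<in> {..<a * b}. Q t \<and> R t} ({t \<in> {..<a}. Q t} \<times> {t \<in> {..<b}. R t})"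
  proof (rule bij_betw_subset[OF f])
    show "?f ` {t \<in> {..<a * b}. Q t \<and> R t} = {t \<in> {..<a}. Q t} \<times> {t \<in> {..<b}. R t}"
    proof (intro equalityI subsetI)
      fix z assume z: "z \<in> {t \<in> {..<a}. Q t} \<times> {t \<in> {..<b}. R t}"
      then have "z \<in> ?f ` {..<a * b}" using f by (auto simp: bij_betw_def)
      then obtain t where t: "t \<in> {..<a * b}" "z = ?f t" by blast
      then have "Q t" "R t" using z Q R by auto
      then show "z \<in> ?f ` {t \<in> {..<a * b}. Q t \<and> R t}" using t by blast
    qed (use assms in auto)
  qed auto
  then show ?thesis by (simp add: bij_betw_same_card card_cartesian_product)
qed

definition root_count :: "int poly \<Rightarrow> nat \<Rightarrow> nat"
  where "root_count G p = card {t \<in> {..<p}. int p dvd poly G (int t)}"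

lemma poly_cong_int:
  fixes G :: "int poly"
  shows "a - b dvd poly G a - poly G b"
proof (induction G)
  case (pCons c G)
  have "poly (pCons c G) a - poly (pCons c G) b = (a - b) * poly G a + b * (poly G a - poly G b)"
    by (simp add: algebra_simps)
  then show ?case using pCons by simp
qed simp

lemma poly_dvd_periodic:
  "int p dvd poly G (int (t mod p)) \<longleftrightarrow> int p dvd poly G (int t)"
proof -
  have "int p dvd int t - int (t mod p)"
    unfolding of_nat_mod by (rule dvd_minus_mod)
  then have "int p dvd poly G (int t) - poly G (int (t mod p))"
    by (rule dvd_trans[OF _ poly_cong_int])
  from dvd_add_right_iff[OF this, of "poly G (int (t mod p))"] show ?thesis
    by (simp only: diff_add_cancel)
qed

lemma root_count_prod:
  assumes "finite B" "\<And>p. p \<in> B \<Longrightarrow> prime p"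
  shows "card {t \<in> {..<\<Prod>B}. \<forall>p\<in>B. int p dvd poly G (int t)} = (\<Prod>p\<in>B. root_count G p)"
  using assms
proof (induction B rule: finite_induct)
  case (insert q B)
  have "(int p dvd poly G (int (t mod \<Prod>B))) = (int p dvd poly G (int t))" if "p \<in> B" for p t
  proof -
    have "p dvd \<Prod>B" using that insert(1) by (meson dvd_prodI dvd_refl dvd_trans)
    then have "t mod \<Prod>B mod p = t mod p" by (rule mod_mod_cancel)
    then show ?thesis by (metis poly_dvd_periodic)
  qed
  then have per: "(\<forall>p\<in>B. int p dvd poly G (int (t mod \<Prod>B))) = (\<forall>p\<in>B. int p dvd poly G (int t))" for t
    by simp
  have pos: "0 < \<Prod>B" "0 < q" using insert by (auto intro!: prod_pos prime_gt_0_nat)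
  have "coprime q (\<Prod>B)"
    using insert by (intro prod_coprime_right primes_coprime) auto
  then have "card {t \<in> {..<q * \<Prod>B}. int q dvd poly G (int t) \<and> (\<forall>p\<in>B. int p dvd poly G (int t))}
     = root_count G q * card {t \<in> {..<\<Prod>B}. \<forall>p\<in>B. int p dvd poly G (int t)}"
    using crt_count[where Q = "\<lambda>t. int q dvd poly G (int t)" and a = q and b = "\<Prod>B"
        and R = "\<lambda>t. \<forall>p\<in>B. int p dvd poly G (int t)", OF _ pos(2,1) poly_dvd_periodic per]
    by (simp add: root_count_def)
  then show ?case using insert by simp
qed (simp add: lessThan_Suc)

text \<open>The remainder term of the sieve: by the Chinese remainder theorem the simultaneous roots
  form a set of period \<open>\<Prod>B\<close>, and the error is at most the number of roots per
  period.\<close>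

lemma card_multiple_roots:
  fixes T N :: nat
  assumes "finite B" "\<And>p. p \<in> B \<Longrightarrow> prime p"
  shows "\<bar>real (card {t \<in> {T..<T + N}. \<forall>p\<in>B. int p dvd poly G (int t)})
     - N * (\<Prod>p\<in>B. root_count G p / p)\<bar> \<le> (\<Prod>p\<in>B. real (root_count G p))"
proof -
  have per: "(\<forall>p\<in>B. int p dvd poly G (int (t + \<Prod>B))) = (\<forall>p\<in>B. int p dvd poly G (int t))" for t
  proof -
    have "(int p dvd poly G (int (t + \<Prod>B))) = (int p dvd poly G (int t))" if "p \<in> B" for p
    proof -
      have "p dvd \<Prod>B" using that assms(1) by (meson dvd_prodI dvd_refl dvd_trans)
      then have "(t + \<Prod>B) mod p = t mod p" by (metis dvdE mod_mult_self2)
      then show ?thesis by (metis poly_dvd_periodic)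
    qed
    then show ?thesis by simp
  qed
  have pos: "0 < \<Prod>B" using assms by (auto intro!: prod_pos prime_gt_0_nat)
  have "\<bar>real (card {t \<in> {T..<T + N}. \<forall>p\<in>B. int p dvd poly G (int t)})
     - N * (real (\<Prod>p\<in>B. root_count G p) / real (\<Prod>B))\<bar> \<le> real (\<Prod>p\<in>B. root_count G p)"
  proof -
    have "(\<Prod>p\<in>B. root_count G p) = card {t \<in> {..<\<Prod>B}. \<forall>p\<in>B. int p dvd poly G (int t)}"
      by (rule root_count_prod[symmetric]) (use assms in auto)
    then show ?thesis
      by (simp only:) (rule periodic_count[where Q = "\<lambda>t. \<forall>p\<in>B. int p dvd poly G (int t)", OF per pos])
  qed
  moreover have "real (\<Prod>p\<in>B. root_count G p) / real (\<Prod>B) = (\<Prod>p\<in>B. root_count G p / p)"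
    by (simp only: of_nat_prod prod_dividef)
  ultimately show ?thesis by (simp only: of_nat_prod)
qed

text \<open>Lagrange's bound, proved over the integers: dividing \<open>G\<close> by
  \<open>x - r\<close> for a root \<open>r\<close> modulo \<open>p\<close> leaves a constant
  remainder divisible by \<open>p\<close>. The value at \<open>s\<close> witnesses that
  \<open>G\<close> is not zero modulo \<open>p\<close>, and the quotient inherits this
  witness.\<close>

lemma root_count_le_degree:
  assumes "prime p" "\<not> int p dvd poly G s"
  shows "root_count G p \<le> degree G"
  using assms(2)
proof (induction "degree G" arbitrary: G)
  case 0
  then obtain c where "G = [:c:]" by (metis degree_eq_zeroE)
  then show ?case using 0 by (simp add: root_count_def)
next
  case (Suc n)
  show ?case
  proof (cases "\<exists>r<p. int p dvd poly G (int r)")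
    case False
    then have "{t \<in> {..<p}. int p dvd poly G (int t)} = {}" by auto
    then show ?thesis unfolding root_count_def by (simp only: card.empty)
  next
    case True
    then obtain r where r: "r < p" "int p dvd poly G (int r)" by blast
    define H where "H = synthetic_div G (int r)"
    have eq: "poly G x = (x - int r) * poly H x + poly G (int r)" for x
    proof -
      have "G + smult (int r) H = pCons (poly G (int r)) H"
        unfolding H_def by (rule synthetic_div_correct)
      from arg_cong[OF this, of "\<lambda>q. poly q x"] show ?thesis by (simp add: algebra_simps)
    qed
    have degH: "n = degree H" using Suc(2) by (simp add: H_def degree_synthetic_div)
    have "\<not> int p dvd poly H s"
      using Suc(3) r(2) eq[of s] by (metis dvd_add dvd_mult)
    from Suc(1)[OF degH this] have IH: "root_count H p \<le> n" using degH by simp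
    have "{t \<in> {..<p}. int p dvd poly G (int t)} \<subseteq> insert r {t \<in> {..<p}. int p dvd poly H (int t)}"
    proof
      fix t assume t: "t \<in> {t \<in> {..<p}. int p dvd poly G (int t)}"
      then have "int p dvd (int t - int r) * poly H (int t)"
        using eq[of "int t"] r(2) by (simp add: dvd_add_left_iff)
      then have "int p dvd int t - int r \<or> int p dvd poly H (int t)"
        using \<open>prime p\<close> prime_dvd_multD[of "int p"] by simp
      moreover have "t = r" if "int p dvd int t - int r"
      proof -
        have "int t mod int p = int r mod int p" using that by (simp add: mod_eq_dvd_iff)
        moreover have "int t mod int p = int t" "int r mod int p = int r"
          using t r(1) by (auto intro!: mod_pos_pos_trivial)
        ultimately show ?thesis by linarith
      qed
      ultimately show "t \<in> insert r {t \<in> {..<p}. int p dvd poly H (int t)}" using t by blast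
    qed
    then have "root_count G p \<le> card (insert r {t \<in> {..<p}. int p dvd poly H (int t)})"
      unfolding root_count_def by (intro card_mono) auto
    also have "\<dots> \<le> Suc (root_count H p)"
      unfolding root_count_def by (simp add: card_insert_if)
    finally have "root_count G p \<le> Suc (root_count H p)" .
    then show ?thesis using IH Suc(2) by simp
  qed
qed

section \<open>Sums of reciprocals of primes\<close>

lemma prod_primes_dvd:
  fixes n :: nat
  assumes "finite B" "\<And>p. p \<in> B \<Longrightarrow> prime p" "\<And>p. p \<in> B \<Longrightarrow> p dvd n"
  shows "\<Prod>B dvd n"
  using assms
proof (induction B rule: finite_induct)
  case (insert q B)
  then have "coprime q (\<Prod>B)" by (intro prod_coprime_right primes_coprime) auto
  then show ?case using insert by (simp add: divides_mult)
qed simp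

text \<open>Chebyshev's argument: with x = 2^j, the primes in (x, 2x] all divide the central
  binomial coefficient of 2x, which is at most 4^x, while each of them exceeds 2^j.\<close>

lemma card_primes_dyadic:
  "j * card {p::nat. prime p \<and> 2 ^ j < p \<and> p \<le> 2 ^ Suc j} \<le> 2 ^ Suc j"
proof -
  let ?P = "{p::nat. prime p \<and> 2 ^ j < p \<and> p \<le> 2 ^ Suc j}" and ?x = "2 ^ j :: nat"
  have fin: "finite ?P" by (rule finite_subset[of _ "{..2 ^ Suc j}"]) auto
  have dvd: "p dvd (2 * ?x) choose ?x" if p: "p \<in> ?P" for p
  proof -
    have "p dvd fact (2 * ?x)" using p by (subst prime_dvd_fact_iff) auto
    moreover have "fact (2 * ?x) = fact ?x * fact ?x * ((2 * ?x) choose ?x)"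
      using binomial_fact_lemma[of ?x "2 * ?x"] by simp
    moreover have "\<not> p dvd fact ?x" using p by (subst prime_dvd_fact_iff) auto
    ultimately show ?thesis using p by (auto simp: prime_dvd_mult_iff)
  qed
  have "\<Prod>?P dvd (2 * ?x) choose ?x"
    using fin dvd by (intro prod_primes_dvd) auto
  then have "\<Prod>?P \<le> (2 * ?x) choose ?x"
    by (intro dvd_imp_le) (auto simp: zero_less_binomial)
  also have "\<dots> \<le> 2 ^ (2 * ?x)" by (rule binomial_le_pow2)
  finally have 1: "\<Prod>?P \<le> 2 ^ (2 * ?x)" .
  have "(2 ^ j) ^ card ?P \<le> \<Prod>?P"
    using prod_mono[of ?P "\<lambda>_. 2 ^ j" "\<lambda>p. p"] by auto
  then have "2 ^ (j * card ?P) \<le> (2::nat) ^ (2 * ?x)" using 1 by (simp add: power_mult)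
  then have "j * card ?P \<le> 2 * ?x" by (subst (asm) power_increasing_iff) auto
  then show ?thesis by simp
qed

text \<open>The range consists of \<open>K\<close> dyadic intervals, and Chebyshev's bound gives at
  most 2/j \<le> 2/K on each. Squaring the endpoint is what makes the bound independent of
  \<open>K\<close>.\<close>

lemma sum_inverse_primes_block:
  assumes "1 \<le> K"
  shows "(\<Sum>p\<in>{p. prime p \<and> 2 ^ K < p \<and> p \<le> 2 ^ (2 * K)}. 1 / real p) \<le> 2"
proof -
  let ?R = "\<lambda>j. {p::nat. prime p \<and> 2 ^ j < p \<and> p \<le> 2 ^ Suc j}"
  have fin: "finite (?R j)" for j by (rule finite_subset[of _ "{..2 ^ Suc j}"]) auto
  have one: "(\<Sum>p\<in>?R j. 1 / real p) \<le> 2 / K" if "K \<le> j" for j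
  proof -
    have "(\<Sum>p\<in>?R j. 1 / real p) \<le> (\<Sum>p\<in>?R j. 1 / 2 ^ j)"
    proof (rule sum_mono)
      fix p assume "p \<in> ?R j"
      then have "real (2 ^ j) \<le> real p" "0 < p" by (auto intro: of_nat_mono prime_gt_0_nat)
      then show "1 / real p \<le> 1 / 2 ^ j"
        using zero_less_power[of "2::real" j] by (intro divide_left_mono mult_pos_pos) auto
    qed
    also have "\<dots> = real (card (?R j)) / 2 ^ j" by simp
    also have "\<dots> \<le> 2 / j"
    proof -
      have "real (j * card (?R j)) \<le> real (2 ^ Suc j)" using card_primes_dyadic by (intro of_nat_mono)
      then show ?thesis using that assms by (simp add: field_simps)
    qed
    also have "\<dots> \<le> 2 / K" using that assms by (intro divide_left_mono) auto
    finally show ?thesis .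
  qed
  have "(\<Sum>p\<in>{p. prime p \<and> 2 ^ K < p \<and> p \<le> 2 ^ (K + L)}. 1 / real p) \<le> L * (2 / K)" for L
  proof (induction L)
    case 0
    have "{p::nat. prime p \<and> 2 ^ K < p \<and> p \<le> 2 ^ (K + 0)} = {}" by auto
    then show ?case by (simp only: sum.empty)
  next
    case (Suc L)
    let ?A = "{p::nat. prime p \<and> 2 ^ K < p \<and> p \<le> 2 ^ (K + L)}"
    have "2 ^ K < p" if "2 ^ (K + L) < p" for p :: nat
      using that by (rule le_less_trans[rotated]) (simp add: power_increasing)
    then have "{p::nat. prime p \<and> 2 ^ K < p \<and> p \<le> 2 ^ (K + Suc L)} = ?A \<union> ?R (K + L)"
      by (auto simp: not_le)
    moreover have "finite ?A" by (rule finite_subset[of _ "{..2 ^ (K + L)}"]) auto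
    ultimately have "(\<Sum>p\<in>{p. prime p \<and> 2 ^ K < p \<and> p \<le> 2 ^ (K + Suc L)}. 1 / real p)
       = (\<Sum>p\<in>?A. 1 / real p) + (\<Sum>p\<in>?R (K + L). 1 / real p)"
      by (simp only:) (rule sum.union_disjoint[OF _ fin], simp, force)
    also have "\<dots> \<le> L * (2 / K) + 2 / K" using Suc one[of "K + L"] by (intro add_mono) auto
    finally show ?case by (simp add: algebra_simps add_divide_distrib)
  qed
  from this[of K] show ?thesis using assms by (simp add: mult_2)
qed

section \<open>The sieve\<close>

lemma sum_subsets_prod_le_exp:
  fixes w :: "nat \<Rightarrow> real"
  assumes "finite P" "\<And>p. p \<in> P \<Longrightarrow> 0 \<le> w p"
  shows "(\<Sum>B\<in>Pow P. prod w B) \<le> exp (sum w P)"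
proof -
  have "(\<Sum>B\<in>Pow P. prod w B) = (\<Prod>p\<in>P. w p + 1)"
    using assms(1) by (subst prod_add) auto
  also have "\<dots> \<le> (\<Prod>p\<in>P. exp (w p))"
    using assms(2) by (intro prod_mono) (auto simp: add.commute)
  finally show ?thesis using assms(1) by (simp add: exp_sum)
qed

lemma symmetric_sum_le_exp:
  assumes "finite P" "\<And>p. p \<in> P \<Longrightarrow> 0 \<le> h p" "0 < x"
  shows "symmetric_sum P k h \<le> exp (x * sum h P) / x ^ k"
proof -
  have "x ^ k * symmetric_sum P k h = (\<Sum>B\<in>{B. B \<subseteq> P \<and> card B = k}. \<Prod>p\<in>B. x * h p)"
    unfolding symmetric_sum_def sum_distrib_left
    by (intro sum.cong) (auto simp: prod.distrib)
  also have "\<dots> \<le> (\<Sum>B\<in>Pow P. \<Prod>p\<in>B. x * h p)"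
    using assms by (intro sum_mono2 prod_nonneg) auto
  also have "\<dots> \<le> exp (\<Sum>p\<in>P. x * h p)"
    using assms by (intro sum_subsets_prod_le_exp) auto
  finally show ?thesis using assms(3) by (simp add: field_simps sum_distrib_left)
qed

text \<open>Rankin's trick in the other direction: each element keeps the weight
  \<open>d / x\<close>, and the factor \<open>x ^ card B\<close>, at most \<open>x ^ k\<close>, is
  taken out.\<close>

lemma sum_subsets_power_le:
  fixes d x :: real and P :: "nat set"
  assumes "finite P" "0 \<le> d" "1 \<le> x"
  shows "(\<Sum>B\<in>{B. B \<subseteq> P \<and> card B \<le> k}. d ^ card B) \<le> x ^ k * exp (d * card P / x)"
proof -
  have "(\<Sum>B\<in>{B. B \<subseteq> P \<and> card B \<le> k}. d ^ card B)
      \<le> (\<Sum>B\<in>{B. B \<subseteq> P \<and> card B \<le> k}. x ^ k * (\<Prod>p\<in>B. d / x))"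
  proof (rule sum_mono)
    fix B assume B: "B \<in> {B. B \<subseteq> P \<and> card B \<le> k}"
    have "d ^ card B = x ^ card B * (\<Prod>p\<in>B. d / x)" using assms by (simp add: power_divide)
    also have "\<dots> \<le> x ^ k * (\<Prod>p\<in>B. d / x)"
      using assms B by (intro mult_right_mono power_increasing prod_nonneg) auto
    finally show "d ^ card B \<le> x ^ k * (\<Prod>p\<in>B. d / x)" .
  qed
  also have "\<dots> = x ^ k * (\<Sum>B\<in>{B. B \<subseteq> P \<and> card B \<le> k}. \<Prod>p\<in>B. d / x)"
    by (simp only: sum_distrib_left)
  also have "\<dots> \<le> x ^ k * (\<Sum>B\<in>Pow P. \<Prod>p\<in>B. d / x)"
    using assms by (intro mult_left_mono sum_mono2 prod_nonneg) auto
  also have "\<dots> \<le> x ^ k * exp (\<Sum>p\<in>P. d / x)"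
    using assms sum_subsets_prod_le_exp[of P "\<lambda>_. d / x"] by (intro mult_left_mono) auto
  finally show ?thesis by (simp add: mult.commute)
qed

lemma prod_one_minus_ge:
  fixes h :: "nat \<Rightarrow> real"
  assumes "finite P" "\<And>p. p \<in> P \<Longrightarrow> 0 \<le> h p \<and> h p \<le> 1 / 2"
  shows "exp (- 2 * sum h P) \<le> (\<Prod>p\<in>P. 1 - h p)"
proof -
  have "exp (- 2 * h p) \<le> 1 - h p" if "p \<in> P" for p
  proof -
    have h: "0 \<le> h p" "h p \<le> 1 / 2" using assms(2)[OF that] by auto
    have "2 * (h p)\<^sup>2 \<le> h p" using mult_left_mono[OF h(2,1)] by (simp add: power2_eq_square)
    then have "- 2 * h p \<le> ln (1 - h p)" using ln_one_minus_pos_lower_bound[OF h] by linarith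
    then have "exp (- 2 * h p) \<le> exp (ln (1 - h p))" by (simp only: exp_le_cancel_iff)
    then show ?thesis using h by simp
  qed
  then have "(\<Prod>p\<in>P. exp (- 2 * h p)) \<le> (\<Prod>p\<in>P. 1 - h p)" by (intro prod_mono) auto
  then show ?thesis using assms(1) by (simp add: exp_sum[symmetric] sum_distrib_left)
qed

text \<open>Each block reaches from y to y^2, so the reciprocals of its primes have a sum bounded
  independently of \<open>j\<close>. The blocks start at \<open>2 ^ 2 ^ D\<close>, beyond which a
  density D/p is at most 1/2.\<close>

definition prime_block :: "nat \<Rightarrow> nat \<Rightarrow> nat set"
  where "prime_block D j = {p. prime p \<and> 2 ^ 2 ^ (D + j) < p \<and> p \<le> 2 ^ 2 ^ (D + Suc j)}"

lemma finite_prime_block [simp]: "finite (prime_block D j)"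
  unfolding prime_block_def by (rule finite_subset[of _ "{..2 ^ 2 ^ (D + Suc j)}"]) auto

lemma prime_block_mono: "i \<le> j \<Longrightarrow> (2::nat) ^ 2 ^ (D + i) \<le> 2 ^ 2 ^ (D + j)"
  by (intro power_increasing) auto

lemma disjoint_prime_block: "disjoint_family (prime_block D)"
proof -
  have "prime_block D i \<inter> prime_block D j = {}" if "i < j" for i j
  proof -
    have "\<not> 2 ^ 2 ^ (D + j) < p" if "p \<le> 2 ^ 2 ^ (D + Suc i)" for p :: nat
      using le_trans[OF that prime_block_mono[OF Suc_leI[OF \<open>i < j\<close>]]] by (rule leD)
    then show ?thesis unfolding prime_block_def by blast
  qed
  then show ?thesis unfolding disjoint_family_on_def by (metis Int_commute linorder_neqE_nat)
qed

lemma prime_block_exhaust: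
  assumes "prime p" "2 ^ 2 ^ D < p" "p \<le> 2 ^ 2 ^ (D + J)"
  shows "\<exists>j<J. p \<in> prime_block D j"
  using assms(3)
proof (induction J)
  case 0
  then show ?case using assms(2) by simp
next
  case (Suc J)
  show ?case
  proof (cases "p \<le> 2 ^ 2 ^ (D + J)")
    case False
    then have "p \<in> prime_block D J" using Suc assms(1) by (simp add: prime_block_def)
    then show ?thesis by blast
  qed (use Suc in \<open>auto intro: less_SucI\<close>)
qed

lemma sum_inverse_prime_block: "(\<Sum>p\<in>prime_block D j. 1 / real p) \<le> 2"
  using sum_inverse_primes_block[of "2 ^ (D + j)"] by (simp add: prime_block_def)

lemma card_prime_block: "card (prime_block D j) \<le> 2 ^ 2 ^ (D + Suc j)"
proof -
  have "card (prime_block D j) \<le> card {1..2 ^ 2 ^ (D + Suc j) :: nat}"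
    by (intro card_mono) (auto simp: prime_block_def intro: prime_ge_1_nat)
  then show ?thesis by simp
qed

text \<open>Bookkeeping for the error of the sieve: \<open>2 ^ j\<close> is the growth of the
  logarithm of a block, and the other factor is its truncation order. The top block dominates, so
  letting the order grow linearly towards the small blocks only adds 2 to \<open>c\<close>.\<close>

lemma sum_weighted_powers_le:
  "(\<Sum>j<J. 2 ^ j * (c + 2 * (J - Suc j))) + 2 \<le> 2 ^ J * (c + 2 :: nat)"
proof (induction J)
  case (Suc J)
  have "(\<Sum>j<J. 2 ^ j * (c + 2 * (Suc J - Suc j)))
     = (\<Sum>j<J. 2 ^ j * (c + 2 * (J - Suc j)) + 2 * 2 ^ j)"
  proof (intro sum.cong refl)
    fix j assume "j \<in> {..<J}"
    then obtain i where "J = Suc (j + i)" using less_imp_Suc_add by auto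
    then show "2 ^ j * (c + 2 * (Suc J - Suc j)) = 2 ^ j * (c + 2 * (J - Suc j)) + 2 * 2 ^ j"
      by (simp add: algebra_simps)
  qed
  also have "\<dots> = (\<Sum>j<J. 2 ^ j * (c + 2 * (J - Suc j))) + 2 * (\<Sum>j<J. 2 ^ j)"
    by (simp add: sum.distrib sum_distrib_left)
  finally have "(\<Sum>j<J. 2 ^ j * (c + 2 * (Suc J - Suc j)))
     = (\<Sum>j<J. 2 ^ j * (c + 2 * (J - Suc j))) + 2 * (\<Sum>j<J. 2 ^ j)" .
  moreover have "(\<Sum>j<J. (2::nat) ^ j) + 1 = 2 ^ J" by (induction J) simp_all
  ultimately show ?case using Suc by (simp add: algebra_simps)
qed simp

text \<open>By averaging: if every value on the interval had a prime factor in the range,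
  \<open>hooley_sum\<close> would be at most 0 at each \<open>t\<close>. Its sum over the interval,
  however, is at least the length times the value at the densities, minus the sum of D^|C| over the
  support, and this is positive. The length is the sieving limit \<open>2 ^ 2 ^ (D + J)\<close> to
  the power \<open>120 * D\<close>.\<close>

theorem brun_hooley:
  fixes G :: "int poly" and D J T :: nat
  assumes D: "1 \<le> D" "degree G \<le> D" and G: "\<And>p. prime p \<Longrightarrow> \<exists>s. \<not> int p dvd poly G s"
  shows "\<exists>t\<in>{T..<T + 2 ^ (120 * D * 2 ^ (D + J))}. \<forall>p. prime p \<longrightarrow> 2 ^ 2 ^ D < p \<longrightarrow>
    p \<le> 2 ^ 2 ^ (D + J) \<longrightarrow> \<not> int p dvd poly G (int t)"
proof (rule ccontr)
  assume contra: "\<not> (\<exists>t\<in>{T..<T + 2 ^ (120 * D * 2 ^ (D + J))}. \<forall>p. prime p \<longrightarrow> 2 ^ 2 ^ D < p \<longrightarrow>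
    p \<le> 2 ^ 2 ^ (D + J) \<longrightarrow> \<not> int p dvd poly G (int t))"
  define Z :: nat where "Z = 2 ^ (D + J)"
  define N :: nat where "N = 2 ^ (120 * D * Z)"
  \<comment> \<open>Odd, as the upper bound requires. The part 24 D outweighs a loss of exp(20 D) in
    the relative errors, and the growth by 2 with each block below the top makes these errors a
    geometric series.\<close>
  define k where "k j = 24 * D + 1 + 2 * (J - Suc j)" for j
  \<comment> \<open>Set to 0 off the primes above \<open>2 ^ 2 ^ D\<close>, the density is at most
    1/2 at every \<open>p\<close>; \<open>hooley_sum_ge\<close> asks for weights below 1
    everywhere.\<close>
  define g where "g p = (if prime p \<and> 2 ^ 2 ^ D < p then root_count G p / p else 0)" for p
  define h where "h t p = (if int p dvd poly G (int t) then 1 else 0 :: real)" for t p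
  let ?P = "prime_block D"
  have odd: "odd (k j)" for j by (simp add: k_def)
  have root_count: "root_count G p \<le> D" if "prime p" for p
    using root_count_le_degree G[OF that] that D(2) le_trans by blast
  have "D < 2 ^ D" by (rule less_exp)
  then have "Suc D \<le> 2 ^ D" by (rule Suc_leI)
  then have "(2::nat) ^ Suc D \<le> 2 ^ 2 ^ D" by (intro power_increasing) auto
  moreover have "2 * D \<le> 2 ^ Suc D" using \<open>D < 2 ^ D\<close> by simp
  ultimately have D2: "2 * D \<le> 2 ^ 2 ^ D" by (rule le_trans[rotated])
  have g: "0 \<le> g p" "g p \<le> 1 / 2" for p
  proof -
    show "0 \<le> g p" by (simp add: g_def)
    have "root_count G p / p \<le> 1 / 2" if p: "prime p" "2 ^ 2 ^ D < p"
    proof -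
      have "2 * root_count G p \<le> p" using root_count[OF p(1)] D2 p(2) by linarith
      then have "2 * real (root_count G p) \<le> p" by (simp flip: of_nat_le_iff)
      then show ?thesis using prime_gt_0_nat[OF p(1)] by (simp add: field_simps)
    qed
    then show "g p \<le> 1 / 2" by (simp add: g_def)
  qed
  have g1: "0 \<le> g p \<and> g p \<le> 1" and g2: "0 \<le> g p \<and> g p < 1" for p
    using g[of p] by auto
  have block_prime: "prime p \<and> 2 ^ 2 ^ D < p" if "p \<in> ?P j" for p j
    using that le_less_trans[OF prime_block_mono[of 0 j D]] by (simp add: prime_block_def)
  have sum_g: "sum g (?P j) \<le> 2 * real D" for j
  proof -
    have "sum g (?P j) \<le> (\<Sum>p\<in>?P j. D * (1 / real p))"
      using block_prime root_count by (intro sum_mono) (auto simp: g_def divide_right_mono)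
    also have "\<dots> = D * (\<Sum>p\<in>?P j. 1 / real p)" by (simp only: sum_distrib_left)
    also have "\<dots> \<le> real D * 2" by (intro mult_left_mono sum_inverse_prime_block) simp
    finally show ?thesis by simp
  qed
  have e4: "exp (real n) \<le> 4 ^ n" for n
    using power_mono[of "exp 1" "4::real" n] exp_le by (simp flip: exp_of_nat_mult)
  have V: "exp (- 4 * real D) \<le> (\<Prod>p\<in>?P j. 1 - g p)" for j
  proof -
    have "exp (- 4 * real D) \<le> exp (- 2 * sum g (?P j))"
      unfolding exp_le_cancel_iff using sum_g[of j] by linarith
    also have "\<dots> \<le> (\<Prod>p\<in>?P j. 1 - g p)" using g by (intro prod_one_minus_ge) auto
    finally show ?thesis .
  qed
  have Vpos: "0 < (\<Prod>p\<in>?P j. 1 - g p)" for j using V[of j] exp_gt_zero[of "- 4 * real D"] by linarith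
  \<comment> \<open>Rankin's trick with x = 8 gives exp(16 D), and division by the block product, at
    least exp(-4 D), makes it exp(20 D) \<le> 2^(40 D). Against this stands \<open>8 ^ k j\<close>,
    whose binary exponent is at least 40 D + 2 + i, where i is the distance from the top
    block.\<close>
  have UV: "symmetric_sum (?P j) (k j) g / (\<Prod>p\<in>?P j. 1 - g p) \<le> 1 / 4 * (1 / 2) ^ (J - Suc j)" for j
  proof -
    let ?i = "J - Suc j"
    have "symmetric_sum (?P j) (k j) g \<le> exp (8 * sum g (?P j)) / 8 ^ k j"
      using g by (intro symmetric_sum_le_exp) auto
    also have "\<dots> \<le> exp (16 * D) / 8 ^ k j"
      using sum_g[of j] by (intro divide_right_mono) auto
    finally have "symmetric_sum (?P j) (k j) g / (\<Prod>p\<in>?P j. 1 - g p)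
        \<le> (exp (16 * D) / 8 ^ k j) / exp (- 4 * real D)"
      using V[of j] by (intro frac_le) auto
    also have "\<dots> = exp (real (20 * D)) / 8 ^ k j" by (simp add: exp_diff[symmetric] exp_minus field_simps flip: exp_add)
    also have "\<dots> \<le> 4 ^ (20 * D) / 8 ^ k j" by (intro divide_right_mono e4) simp
    also have "\<dots> = 2 ^ (40 * D) / 2 ^ (3 * k j)"
      by (simp add: power_mult)
    also have "\<dots> \<le> 2 ^ (40 * D) / 2 ^ (40 * D + 2 + ?i)"
      by (intro divide_left_mono power_increasing) (auto simp: k_def)
    also have "\<dots> = 1 / 4 * (1 / 2) ^ ?i" by (simp add: power_add power_divide)
    finally show ?thesis .
  qed
  have "(\<Sum>j<J. symmetric_sum (?P j) (k j) g / (\<Prod>p\<in>?P j. 1 - g p)) \<le> (\<Sum>j<J. 1 / 4 * (1 / 2) ^ (J - Suc j))"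
    by (intro sum_mono UV)
  also have "\<dots> = 1 / 4 * (\<Sum>i<J. (1 / 2) ^ i)"
    unfolding sum_distrib_left[symmetric] using sum.nat_diff_reindex[of "\<lambda>i. (1 / 2 :: real) ^ i" J] by simp
  also have "\<dots> \<le> 1 / 2" by (simp add: geometric_sum)
  finally have half: "1 / 2 \<le> 1 - (\<Sum>j<J. symmetric_sum (?P j) (k j) g / (\<Prod>p\<in>?P j. 1 - g p))"
    by simp
  have "(1 / 2) ^ (8 * D * J) \<le> (\<Prod>j<J. exp (- 4 * real D))"
  proof -
    have "(\<Prod>j<J. exp (- 4 * real D)) = 1 / exp (real (4 * D * J))"
      by (simp add: exp_minus inverse_eq_divide power_divide mult_ac flip: exp_of_nat_mult)
    moreover have "1 / 4 ^ (4 * D * J) \<le> 1 / exp (real (4 * D * J))"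
      by (intro divide_left_mono e4) auto
    moreover have "(1 / 2) ^ (8 * D * J) = 1 / (4::real) ^ (4 * D * J)"
      using power_mult[of "2::real" 2 "4 * D * J"] by (simp add: power_divide mult.assoc)
    ultimately show ?thesis by simp
  qed
  also have "\<dots> \<le> (\<Prod>j<J. alternating_sum (?P j) (k j) g)"
  proof (intro prod_mono conjI)
    fix j
    have "(\<Prod>p\<in>?P j. 1 - g p) \<le> alternating_sum (?P j) (k j) g"
      by (rule bonferroni(1)[OF finite_prime_block g1 odd])
    then show "exp (- 4 * real D) \<le> alternating_sum (?P j) (k j) g" using V[of j] by linarith
  qed simp
  finally have PY: "(1 / 2) ^ (8 * D * J) \<le> (\<Prod>j<J. alternating_sum (?P j) (k j) g)" .
  have "(1 / 2) ^ (8 * D * J) * (1 / 2)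
      \<le> (\<Prod>j<J. alternating_sum (?P j) (k j) g) *
        (1 - (\<Sum>j<J. symmetric_sum (?P j) (k j) g / (\<Prod>p\<in>?P j. 1 - g p)))"
    by (rule mult_mono[OF PY half order_trans[OF _ PY]]) simp_all
  also have "\<dots> \<le> hooley_sum ?P k J g"
    by (rule hooley_sum_ge[OF finite_prime_block odd g2])
  finally have main: "(1 / 2) ^ (8 * D * J + 1) \<le> hooley_sum ?P k J g" by simp
  obtain c where c: "\<And>C. \<bar>c C\<bar> \<le> 1"
    and expand: "\<And>h. hooley_sum ?P k J h = (\<Sum>C\<in>sieve_support ?P k J. c C * prod h C)"
    using sieve_expansion[OF finite_prime_block disjoint_prime_block] by blast
  let ?S = "sieve_support ?P k J"
  have S: "finite C \<and> (\<forall>p\<in>C. prime p \<and> 2 ^ 2 ^ D < p)" if "C \<in> ?S" for C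
  proof (intro conjI ballI)
    show "finite C" using finite_in_support[OF finite_prime_block that] .
    fix p assume "p \<in> C"
    then obtain j where "p \<in> ?P j" using \<open>C \<in> ?S\<close> unfolding sieve_support_def by blast
    then show "prime p" "2 ^ 2 ^ D < p" using block_prime by blast+
  qed
  have prod_h: "(\<Sum>t\<in>{T..<T + N}. prod (h t) C) = card {t \<in> {T..<T + N}. \<forall>p\<in>C. int p dvd poly G (int t)}"
    if "C \<in> ?S" for C
  proof -
    have "prod (h t) C = (if \<forall>p\<in>C. int p dvd poly G (int t) then 1 else 0)" for t
    proof (cases "\<forall>p\<in>C. int p dvd poly G (int t)")
      case False
      then show ?thesis using S[OF that] by (auto simp: h_def intro!: prod_zero)
    qed (simp add: h_def)
    then show ?thesis by (simp add: sum.If_cases Int_def)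
  qed
  have term_le: "N * (c C * prod g C) - real D ^ card C \<le> c C * (\<Sum>t\<in>{T..<T + N}. prod (h t) C)"
    if C: "C \<in> ?S" for C
  proof -
    let ?A = "\<Sum>t\<in>{T..<T + N}. prod (h t) C"
    have "prod g C = (\<Prod>p\<in>C. root_count G p / p)" using S[OF C] by (intro prod.cong) (auto simp: g_def)
    then have "\<bar>?A - N * prod g C\<bar> \<le> (\<Prod>p\<in>C. real (root_count G p))"
      using card_multiple_roots[of C T N G] S[OF C] unfolding prod_h[OF C] by simp
    also have "\<dots> \<le> (\<Prod>p\<in>C. real D)" using S[OF C] root_count by (intro prod_mono) auto
    finally have "\<bar>?A - N * prod g C\<bar> \<le> real D ^ card C" by simp
    then have "\<bar>c C\<bar> * \<bar>?A - N * prod g C\<bar> \<le> 1 * real D ^ card C" using c by (intro mult_mono) auto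
    then have "\<bar>c C * ?A - N * (c C * prod g C)\<bar> \<le> real D ^ card C"
      by (simp add: abs_mult[symmetric] algebra_simps)
    then show ?thesis by linarith
  qed
  have err: "(\<Sum>C\<in>?S. real D ^ card C) \<le> 2 ^ (108 * D * Z)"
  proof -
    have "(\<Sum>C\<in>?S. real D ^ card C) = (\<Prod>j<J. \<Sum>B\<in>{B. B \<subseteq> ?P j \<and> card B \<le> k j}. real D ^ card B)"
      using sum_sieve_support[OF finite_prime_block disjoint_prime_block, where h = "\<lambda>_. real D" and k = k and J = J]
      by simp
    also have "\<dots> \<le> (\<Prod>j<J. 2 ^ (4 * 2 ^ D * (2 ^ j * k j)))"
    proof (intro prod_mono conjI sum_nonneg)
      fix j
      \<comment> \<open>\<open>?x\<close> is the cube of the lower endpoint 2^E of the block: one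
        factor 2^E covers \<open>D\<close>, the other two the number of primes, so the exponential
        is at most exp 1 and hence below 2^2. Raising 3 E k to 4 E k absorbs these two factors of
        2.\<close>
      let ?E = "2 ^ (D + j) :: nat" and ?x = "2 ^ (3 * 2 ^ (D + j)) :: real"
      have "D \<le> 2 ^ 2 ^ (D + 0)" using D2 by simp
      then have "D \<le> 2 ^ 2 ^ (D + j)" by (rule le_trans[OF _ prime_block_mono]) simp
      then have "D * card (?P j) \<le> 2 ^ ?E * 2 ^ 2 ^ (D + Suc j)"
        by (intro mult_mono card_prime_block) auto
      also have "\<dots> = 2 ^ (3 * ?E)" by (simp add: power_add[symmetric])
      finally have "real (D * card (?P j)) \<le> real (2 ^ (3 * ?E))" by (intro of_nat_mono)
      then have "real D * card (?P j) / ?x \<le> 1" by simp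
      then have "?x ^ k j * exp (real D * card (?P j) / ?x) \<le> ?x ^ k j * exp 1"
        by (intro mult_left_mono) auto
      then have "(\<Sum>B\<in>{B. B \<subseteq> ?P j \<and> card B \<le> k j}. real D ^ card B) \<le> ?x ^ k j * exp 1"
        by (rule order_trans[OF sum_subsets_power_le, rotated 3]) simp_all
      also have "\<dots> \<le> ?x ^ k j * 2 ^ 2" using exp_le by (intro mult_left_mono) auto
      also have "\<dots> = 2 ^ (3 * ?E * k j + 2)" by (simp only: power_mult power_add)
      also have "\<dots> \<le> 2 ^ (4 * 2 ^ D * (2 ^ j * k j))"
      proof (rule power_increasing)
        have "2 ^ 1 \<le> ?E" using D(1) by (intro power_increasing) auto
        then have "2 * 1 \<le> ?E * k j" by (intro mult_mono) (auto simp: k_def)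
        then show "3 * ?E * k j + 2 \<le> 4 * 2 ^ D * (2 ^ j * k j)" by (simp add: power_add mult_ac)
      qed simp
      finally show "(\<Sum>B\<in>{B. B \<subseteq> ?P j \<and> card B \<le> k j}. real D ^ card B) \<le> 2 ^ (4 * 2 ^ D * (2 ^ j * k j))" .
    qed simp
    also have "\<dots> = 2 ^ (4 * 2 ^ D * (\<Sum>j<J. 2 ^ j * k j))"
      by (simp add: power_sum sum_distrib_left)
    also have "\<dots> \<le> 2 ^ (108 * D * Z)"
    proof (rule power_increasing)
      have "(\<Sum>j<J. 2 ^ j * k j) \<le> 2 ^ J * (24 * D + 3)"
        using sum_weighted_powers_le[of "24 * D + 1" J] by (simp add: k_def algebra_simps)
      also have "\<dots> \<le> 2 ^ J * (27 * D)" using D(1) by (intro mult_left_mono) auto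
      finally have "4 * 2 ^ D * (\<Sum>j<J. 2 ^ j * k j) \<le> 4 * 2 ^ D * (2 ^ J * (27 * D))"
        by (rule mult_left_mono) simp
      then show "4 * 2 ^ D * (\<Sum>j<J. 2 ^ j * k j) \<le> 108 * D * Z"
        by (simp add: Z_def power_add algebra_simps)
    qed simp
    finally show ?thesis .
  qed
  \<comment> \<open>The 108 in the error is 4 * 27, from 24 D + 3 \<le> 27 D. The remaining 12 D Z
    of the length pays for the factor 2^-(8 D J + 1) in the main term, since Z \<ge> 2 (J +
    1).\<close>
  have gap: "real N * (1 / 2) ^ (8 * D * J + 1) > 2 ^ (108 * D * Z)"
  proof -
    have "Suc J \<le> 2 ^ J" by (rule Suc_leI[OF less_exp])
    moreover have "2 ^ 1 \<le> (2::nat) ^ D" using D(1) by (intro power_increasing) auto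
    ultimately have "2 * Suc J \<le> Z" unfolding Z_def power_add by (intro mult_mono) auto
    then have "12 * D * (2 * Suc J) \<le> 12 * D * Z" by (rule mult_left_mono) simp
    then have "108 * D * Z + (8 * D * J + 1) < 120 * D * Z" using D(1) by (simp add: algebra_simps)
    then have "(2::real) ^ (108 * D * Z + (8 * D * J + 1)) < 2 ^ (120 * D * Z)"
      by (intro power_strict_increasing) auto
    then show ?thesis unfolding N_def by (simp add: power_add power_divide field_simps)
  qed
  have "2 ^ (108 * D * Z) < N * hooley_sum ?P k J g"
    using gap mult_left_mono[OF main, of "real N"] by simp
  then have "0 < N * hooley_sum ?P k J g - (\<Sum>C\<in>?S. real D ^ card C)" using err by simp
  also have "\<dots> = (\<Sum>C\<in>?S. N * (c C * prod g C) - real D ^ card C)"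
    by (simp only: expand sum_subtractf sum_distrib_left)
  also have "\<dots> \<le> (\<Sum>C\<in>?S. c C * (\<Sum>t\<in>{T..<T + N}. prod (h t) C))"
    by (intro sum_mono term_le)
  also have "\<dots> = (\<Sum>t\<in>{T..<T + N}. hooley_sum ?P k J (h t))"
    unfolding expand sum_distrib_left by (rule sum.swap)
  also have "\<dots> \<le> 0"
  proof (rule sum_nonpos)
    fix t assume "t \<in> {T..<T + N}"
    then obtain p where p: "prime p" "2 ^ 2 ^ D < p" "p \<le> 2 ^ 2 ^ (D + J)" "int p dvd poly G (int t)"
      using contra unfolding N_def Z_def by blast
    then obtain j where j: "j < J" "p \<in> ?P j" using prime_block_exhaust by blast
    have "(\<Prod>p\<in>?P j. 1 - h t p) = 0" using j(2) p(4) by (auto simp: h_def intro!: prod_zero)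
    then have "(\<Prod>j<J. \<Prod>p\<in>?P j. 1 - h t p) = 0" using j(1) by (intro prod_zero) auto
    moreover have "h t p = 0 \<or> h t p = 1" for p by (simp add: h_def)
    ultimately show "hooley_sum ?P k J (h t) \<le> 0"
      using hooley_sum_le[where h = "h t" and J = J and P = ?P and k = k, OF finite_prime_block odd]
      by metis
  qed
  finally show False by simp
qed

section \<open>Almost prime values of a polynomial\<close>

lemma big_Omega_size: "k \<noteq> 0 \<Longrightarrow> big_Omega k = enat (size (prime_factorization k))"
  unfolding big_Omega_def size_multiset_overloaded_eq
  by (auto intro!: sum.cong simp: count_prime_factorization)

lemma big_Omega_mult: "big_Omega (a * b) \<le> big_Omega a + big_Omega b"
proof (cases "a = 0 \<or> b = 0")
  case True
  then have "big_Omega a + big_Omega b = \<infinity>" by (auto simp: big_Omega_def)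
  then show ?thesis by simp
next
  case False
  then show ?thesis by (simp add: big_Omega_size prime_factorization_mult)
qed

lemma big_Omega_dvd_mono:
  assumes "a dvd b"
  shows "big_Omega a \<le> big_Omega b"
proof (cases "b = 0")
  case True
  then show ?thesis by (simp add: big_Omega_def)
next
  case False
  then obtain c where c: "b = a * c" "a \<noteq> 0" "c \<noteq> 0" using assms by auto
  then show ?thesis by (simp add: big_Omega_size prime_factorization_mult)
qed

lemma power_size_le_prod_mset:
  fixes y :: int
  assumes "0 \<le> y" "\<And>p. p \<in># M \<Longrightarrow> y \<le> p"
  shows "y ^ size M \<le> prod_mset M"
  using assms(2)
proof (induction M)
  case (add p M)
  have "y * y ^ size M \<le> p * prod_mset M"
    using add assms(1) order_trans[OF assms(1), of p] by (intro mult_mono) auto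
  then show ?case by simp
qed simp

lemma big_Omega_le:
  fixes k :: int
  assumes "k \<noteq> 0" "\<And>p. prime p \<Longrightarrow> p dvd k \<Longrightarrow> 2 ^ Z \<le> p" "\<bar>k\<bar> < 2 ^ (Z * Suc R)" "0 < Z"
  shows "big_Omega k \<le> enat R"
proof -
  have "(2 ^ Z) ^ size (prime_factorization k) \<le> prod_mset (prime_factorization k)"
    using assms(2) by (intro power_size_le_prod_mset) (auto simp: in_prime_factors_iff)
  also have "\<dots> = \<bar>k\<bar>" using assms(1) by (simp add: prod_mset_prime_factorization)
  also note assms(3)
  finally have "(2::int) ^ (Z * size (prime_factorization k)) < 2 ^ (Z * Suc R)" by (simp add: power_mult)
  then have "Z * size (prime_factorization k) < Z * Suc R" by (rule power_less_imp_less_exp[rotated]) simp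
  then have "size (prime_factorization k) < Suc R" by (rule mult_less_cancel1[THEN iffD1, THEN conjunct2])
  then show ?thesis using assms(1) by (simp add: big_Omega_size)
qed

lemma poly_growth:
  fixes G :: "int poly"
  assumes "degree G \<le> D"
  shows "\<exists>H. \<forall>t. \<bar>poly G (int t)\<bar> \<le> int H * (int t + 1) ^ D"
proof (intro exI allI)
  fix t
  have "\<bar>poly G (int t)\<bar> \<le> (\<Sum>i\<le>degree G. \<bar>coeff G i * int t ^ i\<bar>)"
    unfolding poly_altdef by (rule sum_abs)
  also have "\<dots> \<le> (\<Sum>i\<le>degree G. \<bar>coeff G i\<bar> * (int t + 1) ^ D)"
  proof (rule sum_mono)
    fix i assume "i \<in> {..degree G}"
    then have "int t ^ i \<le> (int t + 1) ^ i" "(int t + 1) ^ i \<le> (int t + 1) ^ D"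
      using assms by (auto intro: power_mono power_increasing)
    then show "\<bar>coeff G i * int t ^ i\<bar> \<le> \<bar>coeff G i\<bar> * (int t + 1) ^ D"
      by (simp add: abs_mult mult_left_mono)
  qed
  also have "\<dots> = int (nat (\<Sum>i\<le>degree G. \<bar>coeff G i\<bar>)) * (int t + 1) ^ D"
    by (simp add: sum_distrib_right sum_nonneg)
  finally show "\<bar>poly G (int t)\<bar> \<le> int (nat (\<Sum>i\<le>degree G. \<bar>coeff G i\<bar>)) * (int t + 1) ^ D" .
qed

text \<open>The free parameter \<open>J\<close> is chosen so that the sieving limit 2^Z exceeds H
  2^D and is at least T. Then t + 1 \<le> 2 N, so |G(t)| \<le> H 2^D N^D < 2^Z N^D, and N = 2^(120 D
  Z) leaves room for at most 120 D^2 prime factors of size at least 2^Z.\<close>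

lemma almost_prime_values:
  fixes G :: "int poly"
  assumes D: "1 \<le> D" "degree G \<le> D" and G: "\<And>p. prime p \<Longrightarrow> \<exists>s. \<not> int p dvd poly G s"
    and small: "\<And>p t. prime p \<Longrightarrow> p \<le> 2 ^ 2 ^ D \<Longrightarrow> \<not> int p dvd poly G t"
  shows "\<exists>t\<ge>T. big_Omega (poly G (int t)) \<le> enat (120 * D\<^sup>2)"
proof -
  obtain H where H: "\<And>t. \<bar>poly G (int t)\<bar> \<le> int H * (int t + 1) ^ D"
    using poly_growth[OF D(2)] by blast
  define J where "J = H * 2 ^ D + T"
  define Z :: nat where "Z = 2 ^ (D + J)"
  define N :: nat where "N = 2 ^ (120 * D * Z)"
  obtain t where t: "t \<in> {T..<T + N}"
    and rough: "\<And>p. prime p \<Longrightarrow> 2 ^ 2 ^ D < p \<Longrightarrow> p \<le> 2 ^ Z \<Longrightarrow> \<not> int p dvd poly G (int t)"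
    using brun_hooley[of D G T J, OF D G] unfolding N_def Z_def by blast
  have "J < 2 ^ J" by (rule less_exp)
  also have "\<dots> \<le> Z" unfolding Z_def by (intro power_increasing) auto
  finally have "J < Z" .
  then have "Z > 0" by simp
  have "Z < 2 ^ Z" by (rule less_exp)
  then have HZ: "H * 2 ^ D < 2 ^ Z" and TZ: "T \<le> 2 ^ Z" using \<open>J < Z\<close> unfolding J_def by linarith+
  have "Z \<le> 120 * D * Z" using D(1) by simp
  then have "(2::nat) ^ Z \<le> N" unfolding N_def by (intro power_increasing) auto
  then have "t + 1 \<le> 2 * N" using t TZ by simp
  then have "H * (t + 1) ^ D \<le> H * (2 * N) ^ D" by (intro mult_left_mono power_mono) auto
  also have "\<dots> = (H * 2 ^ D) * 2 ^ (120 * D * Z * D)"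
    unfolding N_def by (simp only: power_mult_distrib power_mult mult.assoc)
  also have "\<dots> < 2 ^ Z * 2 ^ (120 * D * Z * D)" using HZ by (intro mult_strict_right_mono) auto
  also have "\<dots> = 2 ^ (Z * Suc (120 * D\<^sup>2))"
    by (simp add: power_add[symmetric] power2_eq_square mult_ac)
  finally have "H * (t + 1) ^ D < 2 ^ (Z * Suc (120 * D\<^sup>2))" .
  then have "int (H * (t + 1) ^ D) < int (2 ^ (Z * Suc (120 * D\<^sup>2)))" by (simp only: of_nat_less_iff)
  then have "int H * (int t + 1) ^ D < 2 ^ (Z * Suc (120 * D\<^sup>2))"
    by (simp only: of_nat_mult of_nat_power of_nat_add of_nat_1 of_nat_numeral)
  with H[of t] have *: "\<bar>poly G (int t)\<bar> < 2 ^ (Z * Suc (120 * D\<^sup>2))" by (rule le_less_trans)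
  \<comment> \<open>The prime 2 is covered by \<open>small\<close>, so the value is odd and in
    particular nonzero.\<close>
  have "(2::nat) ^ 1 \<le> 2 ^ 2 ^ D" by (intro power_increasing) auto
  then have "poly G (int t) \<noteq> 0" using small[of 2 "int t"] by auto
  moreover have "2 ^ Z \<le> p" if "prime p" "p dvd poly G (int t)" for p :: int
  proof -
    define q where "q = nat p"
    have q: "p = int q" using prime_ge_0_int[OF that(1)] by (simp add: q_def)
    then have q: "prime q" "p = int q" using that(1) by simp_all
    then have "\<not> q \<le> 2 ^ 2 ^ D" using small that(2) by blast
    then have "\<not> q \<le> 2 ^ Z" using rough[OF q(1)] that(2) q(2) by (metis not_le)
    then have "int (2 ^ Z) \<le> int q" by simp
    then show ?thesis using q by simp
  qed
  ultimately have "big_Omega (poly G (int t)) \<le> enat (120 * D\<^sup>2)"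
    using * \<open>Z > 0\<close> by (intro big_Omega_le) auto
  then show ?thesis using t by auto
qed

text \<open>Write r(x) = A + x s(x). Substituting x = A w! t makes the second term divisible by A
  w!, so A splits off and the cofactor is 1 modulo w!. The value 1 at 0 shows later that
  \<open>G\<close> does not vanish identically modulo any prime.\<close>

lemma line_values_factor:
  fixes r :: "int poly" and w :: nat
  assumes "poly r 0 = A" "A \<noteq> 0"
  defines "Q \<equiv> A * fact w"
  shows "\<exists>G. degree G \<le> degree r \<and> (\<forall>t. poly r (Q * t) = A * poly G t) \<and> poly G 0 = 1 \<and>
    (\<forall>p t. prime p \<longrightarrow> p \<le> w \<longrightarrow> \<not> int p dvd poly G t)"
proof -
  obtain c s where r: "r = pCons c s" by (rule pCons_cases)
  have c: "c = A" using assms(1) r by simp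
  define G where "G = 1 + smult (fact w) (pCons 0 (pcompose s [:0, Q:]))"
  have Q: "Q \<noteq> 0" using assms by simp
  have "degree G \<le> degree r"
  proof (cases "s = 0")
    case False
    then have "degree (pCons 0 (pcompose s [:0, Q:])) \<le> degree r"
      using Q by (intro order_trans[OF degree_pCons_le]) (simp add: r degree_pcompose)
    then show ?thesis unfolding G_def
      by (intro degree_add_le) (auto intro: order_trans[OF degree_smult_le])
  qed (simp add: G_def)
  moreover have "poly r (Q * t) = A * poly G t" for t
    by (simp add: r c G_def poly_pcompose Q_def algebra_simps)
  moreover have "\<not> int p dvd poly G t" if "prime p" "p \<le> w" for p t
  proof
    assume "int p dvd poly G t"
    moreover have "p dvd fact w" using that by (simp add: prime_dvd_fact_iff)
    then have "int p dvd fact w" by (metis of_nat_dvd_iff of_nat_fact)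
    moreover have "poly G t = 1 + fact w * (t * poly (pcompose s [:0, Q:]) t)" by (simp add: G_def mult_ac)
    ultimately have "int p dvd 1" by (metis dvd_add_left_iff dvd_mult2)
    then show False using that(1) by (simp add: prime_nat_iff)
  qed
  moreover have "poly G 0 = 1" by (simp add: G_def)
  ultimately show ?thesis by blast
qed

section \<open>Forms with integral coefficients\<close>

text \<open>Monomials and coefficients are passed separately so that the same substitution serves
  over the integers, where the sieve works, and over the complex numbers, where \<open>cpoly\<close>
  lives.\<close>

definition poly_subst :: "(nat \<Rightarrow>\<^sub>0 nat) set \<Rightarrow> ((nat \<Rightarrow>\<^sub>0 nat) \<Rightarrow> 'a) \<Rightarrow> (nat \<Rightarrow> 'a::idom poly) \<Rightarrow> 'a poly"
  where "poly_subst M c q = (\<Sum>a\<in>M. smult (c a) (\<Prod>i\<in>vars a. q i ^ Poly_Mapping.lookup a i))"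

lemma poly_poly_subst:
  "poly (poly_subst M c q) t = (\<Sum>a\<in>M. c a * (\<Prod>i\<in>vars a. poly (q i) t ^ Poly_Mapping.lookup a i))"
  by (simp add: poly_subst_def poly_sum poly_prod)

lemma poly_poly_subst_complex:
  "poly (poly_subst (monomials p) (coefficient p) q) t = peval p (\<lambda>i. poly (q i) t)"
  by (simp add: poly_poly_subst peval_def mon_eval_def)

lemma degree_poly_subst_le:
  assumes "finite M" "\<And>a. a \<in> M \<Longrightarrow> mon_degree a \<le> D" "\<And>i. degree (q i) \<le> 1"
  shows "degree (poly_subst M c q) \<le> D"
  unfolding poly_subst_def
proof (rule degree_sum_le[OF assms(1)])
  fix a assume a: "a \<in> M"
  have "degree (smult (c a) (\<Prod>i\<in>vars a. q i ^ Poly_Mapping.lookup a i))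
      \<le> degree (\<Prod>i\<in>vars a. q i ^ Poly_Mapping.lookup a i)"
    by (rule degree_smult_le)
  also have "\<dots> \<le> (\<Sum>i\<in>vars a. degree (q i ^ Poly_Mapping.lookup a i))"
    using degree_prod_sum_le[of "vars a" "\<lambda>i. q i ^ Poly_Mapping.lookup a i"] by (simp add: o_def)
  also have "\<dots> \<le> (\<Sum>i\<in>vars a. Poly_Mapping.lookup a i)"
  proof (rule sum_mono)
    fix i
    have "degree (q i ^ Poly_Mapping.lookup a i) \<le> degree (q i) * Poly_Mapping.lookup a i"
      by (rule degree_power_le)
    also have "\<dots> \<le> 1 * Poly_Mapping.lookup a i" by (rule mult_right_mono[OF assms(3)]) simp
    finally show "degree (q i ^ Poly_Mapping.lookup a i) \<le> Poly_Mapping.lookup a i" by simp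
  qed
  finally show "degree (smult (c a) (\<Prod>i\<in>vars a. q i ^ Poly_Mapping.lookup a i)) \<le> D"
    using assms(2)[OF a] by (simp add: mon_degree_def)
qed

lemma integral_line_poly:
  assumes "\<And>a. coefficient F a \<in> \<int>" "\<And>a. a \<in> monomials F \<Longrightarrow> mon_degree a \<le> D"
  shows "\<exists>r :: int poly. degree r \<le> D \<and>
    (\<forall>t. of_int (poly r t) = peval F (\<lambda>i. of_int (u i + t * b i)))"
proof -
  have "\<exists>z. coefficient F a = of_int z" for a using assms(1)[of a] by (auto elim: Ints_cases)
  then obtain c where c: "\<And>a. coefficient F a = of_int (c a)" by metis
  let ?r = "poly_subst (monomials F) c (\<lambda>i. [:u i, b i:])"
  have "degree ?r \<le> D"
    using assms(2) by (intro degree_poly_subst_le) (auto intro: order_trans[OF degree_pCons_le])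
  moreover have "of_int (poly ?r t) = peval F (\<lambda>i. of_int (u i + t * b i))" for t
    by (simp add: poly_poly_subst peval_def mon_eval_def c)
  ultimately show ?thesis by blast
qed

text \<open>Induction on the variables: a coefficient in one variable is the part of the sum over the
  monomials with a fixed exponent of that variable.\<close>

lemma grid_nonvanishing:
  fixes c :: "(nat \<Rightarrow>\<^sub>0 nat) \<Rightarrow> complex"
  assumes "finite S" "finite M" "a \<in> M" "c a \<noteq> 0"
    and "\<And>b i. b \<in> M \<Longrightarrow> Poly_Mapping.lookup b i \<le> D"
    and "\<And>b b'. b \<in> M \<Longrightarrow> b' \<in> M \<Longrightarrow> \<forall>i\<in>S. Poly_Mapping.lookup b i = Poly_Mapping.lookup b' i \<Longrightarrow> b = b'"
  shows "\<exists>v :: nat \<Rightarrow> nat. (\<forall>i. v i \<le> D) \<and> (\<forall>i. i \<notin> S \<longrightarrow> v i = 0) \<and>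
    (\<Sum>b\<in>M. c b * (\<Prod>i\<in>S. of_nat (v i) ^ Poly_Mapping.lookup b i)) \<noteq> 0"
  using assms
proof (induction S arbitrary: M rule: finite_induct)
  case empty
  then have "M = {a}" by auto
  then show ?case using empty by (intro exI[of _ "\<lambda>_. 0"]) simp
next
  case (insert x S)
  let ?M = "{b \<in> M. Poly_Mapping.lookup b x = Poly_Mapping.lookup a x}"
  have "\<exists>v :: nat \<Rightarrow> nat. (\<forall>i. v i \<le> D) \<and> (\<forall>i. i \<notin> S \<longrightarrow> v i = 0) \<and>
    (\<Sum>b\<in>?M. c b * (\<Prod>i\<in>S. of_nat (v i) ^ Poly_Mapping.lookup b i)) \<noteq> 0"
  proof (rule insert.IH)
    fix b b' assume "b \<in> ?M" "b' \<in> ?M"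
      "\<forall>i\<in>S. Poly_Mapping.lookup b i = Poly_Mapping.lookup b' i"
    then show "b = b'" using insert.prems(5)[of b b'] by auto
  qed (use insert.prems in auto)
  then obtain v :: "nat \<Rightarrow> nat" where v: "\<And>i. v i \<le> D" "\<And>i. i \<notin> S \<Longrightarrow> v i = 0"
    "(\<Sum>b\<in>?M. c b * (\<Prod>i\<in>S. of_nat (v i) ^ Poly_Mapping.lookup b i)) \<noteq> 0" by blast
  let ?w = "\<lambda>b. c b * (\<Prod>i\<in>S. of_nat (v i) ^ Poly_Mapping.lookup b i)"
  define q where "q = (\<Sum>b\<in>M. monom (?w b) (Poly_Mapping.lookup b x))"
  have "coeff q (Poly_Mapping.lookup a x) = (\<Sum>b\<in>?M. ?w b)"
    using insert.prems(1) by (simp add: q_def coeff_sum sum.If_cases Int_def conj_commute)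
  then have "q \<noteq> 0" using v(3) by auto
  have "degree q \<le> D"
    unfolding q_def using insert.prems(1,4)
    by (intro degree_sum_le) (auto intro: order_trans[OF degree_monom_le])
  have "\<exists>t\<le>D. poly q (of_nat t) \<noteq> 0"
  proof (rule ccontr)
    assume "\<not> ?thesis"
    then have "of_nat ` {..D} \<subseteq> {z. poly q z = 0}" by auto
    then have "card (of_nat ` {..D} :: complex set) \<le> card {z. poly q z = 0}"
      using poly_roots_finite[OF \<open>q \<noteq> 0\<close>] by (intro card_mono)
    also have "\<dots> \<le> degree q" by (rule card_poly_roots_bound[OF \<open>q \<noteq> 0\<close>])
    finally have "card (of_nat ` {..D} :: complex set) \<le> D" using \<open>degree q \<le> D\<close> by simp
    then show False by (simp add: card_image inj_on_def)
  qed
  then obtain t where t: "t \<le> D" "poly q (of_nat t) \<noteq> 0" by blast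
  have "(\<Prod>i\<in>insert x S. of_nat ((v(x := t)) i) ^ Poly_Mapping.lookup b i)
      = (of_nat t :: complex) ^ Poly_Mapping.lookup b x * (\<Prod>i\<in>S. of_nat (v i) ^ Poly_Mapping.lookup b i)" for b
  proof -
    have "(\<Prod>i\<in>S. of_nat ((v(x := t)) i) ^ Poly_Mapping.lookup b i)
      = (\<Prod>i\<in>S. (of_nat (v i) :: complex) ^ Poly_Mapping.lookup b i)"
      using insert.hyps by (intro prod.cong) auto
    then show ?thesis using insert.hyps by simp
  qed
  then have "(\<Sum>b\<in>M. c b * (\<Prod>i\<in>insert x S. of_nat ((v(x := t)) i) ^ Poly_Mapping.lookup b i)) = poly q (of_nat t)"
    by (simp add: q_def poly_sum poly_monom mult_ac)
  then show ?case using v t insert.hyps by (intro exI[of _ "v(x := t)"]) auto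
qed

text \<open>All but finitely many coefficients are 0, so the set under \<open>Max\<close> is
  finite.\<close>

lemma max_coeff_ge: "cmod (coefficient F a) \<le> max_coeff F"
proof -
  have "range (\<lambda>a. cmod (coefficient F a)) \<subseteq> insert 0 ((\<lambda>a. cmod (coefficient F a)) ` monomials F)"
    by (auto simp: in_keys_iff)
  then have "finite (range (\<lambda>a. cmod (coefficient F a)))" by (rule finite_subset) simp
  then show ?thesis unfolding max_coeff_def by (intro Max_ge) auto
qed

lemma lookup_le_mon_degree: "Poly_Mapping.lookup a i \<le> mon_degree a"
  unfolding mon_degree_def by (cases "i \<in> vars a") (auto intro: member_le_sum simp: in_keys_iff)

lemma card_vars_le_mon_degree: "card (vars a) \<le> mon_degree a"
proof -
  have "(\<Sum>i\<in>vars a. 1) \<le> (\<Sum>i\<in>vars a. Poly_Mapping.lookup a i)"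
    by (intro sum_mono) (auto simp: in_keys_iff Suc_le_eq)
  then show ?thesis by (simp add: mon_degree_def)
qed

lemma mon_eval_le_power:
  assumes "\<And>i. v i \<le> D" "1 \<le> D" "mon_degree b \<le> D"
  shows "cmod (mon_eval (\<lambda>i. of_nat (v i)) b) \<le> real D ^ D"
proof -
  have "cmod (mon_eval (\<lambda>i. of_nat (v i)) b) = (\<Prod>i\<in>vars b. real (v i) ^ Poly_Mapping.lookup b i)"
    by (simp add: mon_eval_def prod_norm[symmetric] norm_power)
  also have "\<dots> \<le> (\<Prod>i\<in>vars b. real D ^ Poly_Mapping.lookup b i)"
    using assms(1) by (intro prod_mono) (auto intro: power_mono)
  also have "\<dots> = real D ^ mon_degree b" by (simp add: mon_degree_def power_sum)
  also have "\<dots> \<le> real D ^ D" using assms by (intro power_increasing) auto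
  finally show ?thesis .
qed

text \<open>Only the variables of one monomial of \<open>F\<close> are made nonzero, so that the bound does not
  depend on the number of variables.\<close>

lemma small_nonzero_value:
  assumes "F \<noteq> 0" "1 \<le> D" "\<And>a. a \<in> monomials F \<Longrightarrow> mon_degree a \<le> D \<and> vars a \<subseteq> {..m}"
  shows "\<exists>v :: nat \<Rightarrow> nat. (\<forall>i>m. v i = 0) \<and> peval F (\<lambda>i. of_nat (v i)) \<noteq> 0 \<and>
    cmod (peval F (\<lambda>i. of_nat (v i))) \<le> 2 ^ (2 * D\<^sup>2) * max_coeff F"
proof -
  obtain a where a: "a \<in> monomials F" using assms(1) by fastforce
  let ?S = "vars a"
  \<comment> \<open>The monomials that survive when the variables outside \<open>?S\<close> are set
    to 0. Each is determined by at most \<open>D\<close> exponents not exceeding \<open>D\<close>,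
    which gives the count (D + 1)^D below.\<close>
  define M where "M = {b \<in> monomials F. vars b \<subseteq> ?S}"
  have finM: "finite M" unfolding M_def by simp
  have le: "Poly_Mapping.lookup b i \<le> D" if "b \<in> M" for b i
    using that assms(3)[of b] lookup_le_mon_degree[of b i] by (auto simp: M_def)
  have inj: "b = b'" if "b \<in> M" "b' \<in> M" "\<forall>i\<in>?S. Poly_Mapping.lookup b i = Poly_Mapping.lookup b' i" for b b'
  proof (rule poly_mapping_eqI)
    fix i
    show "Poly_Mapping.lookup b i = Poly_Mapping.lookup b' i"
    proof (cases "i \<in> ?S")
      case False
      then have "i \<notin> vars b" "i \<notin> vars b'" using that(1,2) by (auto simp: M_def)
      then show ?thesis by (simp add: in_keys_iff)
    qed (use that(3) in blast)
  qed
  have "\<exists>v :: nat \<Rightarrow> nat. (\<forall>i. v i \<le> D) \<and> (\<forall>i. i \<notin> ?S \<longrightarrow> v i = 0) \<and>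
    (\<Sum>b\<in>M. coefficient F b * (\<Prod>i\<in>?S. of_nat (v i) ^ Poly_Mapping.lookup b i)) \<noteq> 0"
    by (rule grid_nonvanishing[OF finite_keys finM _ _ le inj, of a])
       (use a in \<open>auto simp: M_def in_keys_iff\<close>)
  then obtain v :: "nat \<Rightarrow> nat" where v: "\<And>i. v i \<le> D" "\<And>i. i \<notin> ?S \<Longrightarrow> v i = 0"
    and nz: "(\<Sum>b\<in>M. coefficient F b * (\<Prod>i\<in>?S. of_nat (v i) ^ Poly_Mapping.lookup b i)) \<noteq> 0"
    by blast
  have eval: "mon_eval (\<lambda>i. of_nat (v i)) b = (if b \<in> M then \<Prod>i\<in>?S. of_nat (v i) ^ Poly_Mapping.lookup b i else 0)"
    if b: "b \<in> monomials F" for b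
  proof (cases "b \<in> M")
    case True
    then show ?thesis by (simp add: mon_eval_superset[of ?S] M_def)
  next
    case False
    then obtain i where i: "i \<in> vars b" "i \<notin> ?S" using b by (auto simp: M_def)
    then have "of_nat (v i) ^ Poly_Mapping.lookup b i = (0 :: complex)"
      using v(2) by (simp add: in_keys_iff)
    then have "mon_eval (\<lambda>i. of_nat (v i)) b = 0"
      unfolding mon_eval_def by (intro prod_zero finite_keys bexI[OF _ i(1)])
    then show ?thesis using False by simp
  qed
  have M: "peval F (\<lambda>i. of_nat (v i)) = (\<Sum>b\<in>M. coefficient F b * mon_eval (\<lambda>i. of_nat (v i)) b)"
    unfolding peval_def by (rule sum.mono_neutral_right) (auto simp: eval M_def)
  also have "\<dots> = (\<Sum>b\<in>M. coefficient F b * (\<Prod>i\<in>?S. of_nat (v i) ^ Poly_Mapping.lookup b i))"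
    by (intro sum.cong refl) (auto simp: eval M_def)
  finally have "peval F (\<lambda>i. of_nat (v i)) \<noteq> 0" using nz by simp
  moreover have "cmod (peval F (\<lambda>i. of_nat (v i))) \<le> 2 ^ (2 * D\<^sup>2) * max_coeff F"
  proof -
    have C0: "0 \<le> max_coeff F" using max_coeff_ge[of F 0] norm_ge_zero order_trans by blast
    have "card M \<le> card (PiE ?S (\<lambda>_. {..D}))"
    proof (rule card_inj_on_le)
      show "inj_on (\<lambda>b. restrict (Poly_Mapping.lookup b) ?S) M"
      proof (rule inj_onI)
        fix b b' assume b: "b \<in> M" "b' \<in> M"
          and eq: "restrict (Poly_Mapping.lookup b) ?S = restrict (Poly_Mapping.lookup b') ?S"
        have "Poly_Mapping.lookup b i = Poly_Mapping.lookup b' i" if "i \<in> ?S" for i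
          using fun_cong[OF eq, of i] that by simp
        then show "b = b'" using inj[OF b] by blast
      qed
      show "(\<lambda>b. restrict (Poly_Mapping.lookup b) ?S) ` M \<subseteq> PiE ?S (\<lambda>_. {..D})"
        using le by auto
    qed (auto intro: finite_PiE)
    also have "\<dots> = Suc D ^ card ?S" by (simp add: card_PiE)
    also have "\<dots> \<le> Suc D ^ D"
      using assms(3)[OF a] card_vars_le_mon_degree[of a] by (intro power_increasing) auto
    finally have cardM: "card M \<le> Suc D ^ D" .
    have "cmod (peval F (\<lambda>i. of_nat (v i))) \<le> (\<Sum>b\<in>M. cmod (coefficient F b * mon_eval (\<lambda>i. of_nat (v i)) b))"
      unfolding M by (rule norm_sum)
    also have "\<dots> \<le> (\<Sum>b\<in>M. max_coeff F * real D ^ D)"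
    proof (rule sum_mono)
      fix b assume "b \<in> M"
      then have "cmod (mon_eval (\<lambda>i. of_nat (v i)) b) \<le> real D ^ D"
        using assms(2,3) v(1) by (intro mon_eval_le_power) (auto simp: M_def)
      then show "cmod (coefficient F b * mon_eval (\<lambda>i. of_nat (v i)) b) \<le> max_coeff F * real D ^ D"
        unfolding norm_mult using max_coeff_ge C0 by (intro mult_mono) auto
    qed
    also have "\<dots> = real (card M * D ^ D) * max_coeff F" by simp
    also have "\<dots> \<le> 2 ^ (2 * D\<^sup>2) * max_coeff F"
    proof (rule mult_right_mono[OF _ C0])
      have S: "Suc D \<le> 2 ^ D" by (rule Suc_leI[OF less_exp])
      have "card M * D ^ D \<le> Suc D ^ D * Suc D ^ D" using cardM by (intro mult_mono power_mono) auto
      also have "\<dots> \<le> (2 ^ D) ^ D * (2 ^ D) ^ D" by (intro mult_mono power_mono S) auto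
      also have "\<dots> = 2 ^ (2 * D\<^sup>2)"
        by (simp only: power_mult[symmetric] power_add[symmetric] power2_eq_square mult_2)
      finally have "real (card M * D ^ D) \<le> real (2 ^ (2 * D\<^sup>2))" by (simp only: of_nat_le_iff)
      then show "real (card M * D ^ D) \<le> 2 ^ (2 * D\<^sup>2)" by simp
    qed
    finally show ?thesis .
  qed
  moreover have "v i = 0" if "i > m" for i using v(2) assms(3)[OF a] that by fastforce
  ultimately show ?thesis by blast
qed

text \<open>The coordinates are moved one at a time: along a coordinate line the function is a
  polynomial, nonzero at the present value, so it vanishes at only finitely many elements of the
  infinite set \<open>L x\<close>.\<close>

lemma move_to_lattice:
  fixes \<phi> :: "(nat \<Rightarrow> complex) \<Rightarrow> complex"
  assumes "finite S" "\<phi> w \<noteq> 0" "\<And>i. infinite (L i)"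
    and line: "\<And>u b. \<exists>r. \<forall>t. poly r t = \<phi> (\<lambda>i. u i + t * b i)"
  shows "\<exists>w'. (\<forall>i\<in>S. w' i \<in> L i) \<and> (\<forall>i. i \<notin> S \<longrightarrow> w' i = w i) \<and> \<phi> w' \<noteq> 0"
  using assms(1)
proof (induction S rule: finite_induct)
  case empty
  then show ?case using assms(2) by blast
next
  case (insert x S)
  then obtain w' where w': "\<forall>i\<in>S. w' i \<in> L i" "\<forall>i. i \<notin> S \<longrightarrow> w' i = w i" "\<phi> w' \<noteq> 0" by blast
  obtain r where r: "\<And>t. poly r t = \<phi> (\<lambda>i. (w'(x := 0)) i + t * (if i = x then 1 else 0))"
    using line by metis
  have upd: "(\<lambda>i. (w'(x := 0)) i + t * (if i = x then 1 else 0)) = w'(x := t)" for t by auto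
  have "poly r (w' x) \<noteq> 0" using w'(3) unfolding r upd by simp
  then have "r \<noteq> 0" by auto
  then have "finite {t. poly r t = 0}" by (rule poly_roots_finite)
  then obtain t where t: "t \<in> L x" "poly r t \<noteq> 0"
    using assms(3)[of x] finite_subset[of "L x" "{t. poly r t = 0}"] by blast
  show ?case
  proof (intro exI conjI)
    show "\<phi> (w'(x := t)) \<noteq> 0" using t(2) unfolding r upd .
  qed (use t(1) w'(1,2) insert.hyps in auto)
qed

section \<open>Density of almost prime points\<close>

text \<open>\<open>\<phi>\<close> stands for the equation of the hypersurface to be avoided, pulled
  back to the source. Being polynomial on lines is a property that a composite of forms has without
  being expanded into a \<open>cpoly\<close>.\<close>

lemma almost_prime_point:
  fixes \<phi> :: "(nat \<Rightarrow> complex) \<Rightarrow> complex" and u :: "nat \<Rightarrow> int"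
  assumes F: "\<And>a. coefficient F a \<in> \<int>" "\<And>a. a \<in> monomials F \<Longrightarrow> mon_degree a \<le> D" and "1 \<le> D"
    and u: "\<And>i. i > m \<Longrightarrow> u i = 0" "peval F (\<lambda>i. of_int (u i)) = of_int A" "A \<noteq> 0"
    and w: "\<And>i. i > m \<Longrightarrow> w i = 0" "\<phi> w \<noteq> 0"
    and line: "\<And>u b. \<exists>r. \<forall>t. poly r t = \<phi> (\<lambda>i. u i + t * b i)"
  shows "\<exists>v k. (\<forall>i>m. v i = 0) \<and> \<phi> (\<lambda>i. of_int (v i)) \<noteq> 0 \<and> k \<noteq> 0 \<and>
    peval F (\<lambda>i. of_int (v i)) = of_int k \<and> big_Omega k \<le> big_Omega A + enat (120 * D\<^sup>2)"
proof -
  define W :: nat where "W = 2 ^ 2 ^ D"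
  define Q where "Q = A * fact W"
  have Q: "Q \<noteq> 0" using u(3) by (simp add: Q_def)
  \<comment> \<open>Coordinates of the points u + Q b with b integral. Such a point off the zero set
    of \<open>\<phi>\<close> supplies a direction in which the line through \<open>u\<close> leaves
    that set.\<close>
  let ?L = "\<lambda>i. range (\<lambda>z. of_int (u i + Q * z) :: complex)"
  have inf: "infinite (?L i)" for i
    using Q by (auto dest!: finite_imageD simp: inj_on_def infinite_UNIV_char_0)
  have "\<exists>w'. (\<forall>i\<in>{..m}. w' i \<in> ?L i) \<and> (\<forall>i. i \<notin> {..m} \<longrightarrow> w' i = w i) \<and> \<phi> w' \<noteq> 0"
    by (rule move_to_lattice[OF finite_atMost w(2) inf line])
  then obtain w' where w': "\<And>i. i \<le> m \<Longrightarrow> w' i \<in> ?L i" "\<And>i. \<not> i \<le> m \<Longrightarrow> w' i = w i" "\<phi> w' \<noteq> 0"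
    unfolding atMost_iff by blast
  have "\<exists>z. w' i = of_int (u i + Q * z) \<and> (i > m \<longrightarrow> z = 0)" for i
  proof (cases "i \<le> m")
    case True
    then show ?thesis using w'(1)[of i] by auto
  next
    case False
    then show ?thesis using w'(2) w(1) u(1) by (intro exI[of _ 0]) simp
  qed
  then obtain b where b: "\<And>i. w' i = of_int (u i + Q * b i)" "\<And>i. i > m \<Longrightarrow> b i = 0" by metis
  obtain r :: "int poly" where r: "degree r \<le> D"
    "\<And>t. of_int (poly r t) = peval F (\<lambda>i. of_int (u i + t * b i))"
    using integral_line_poly[where F = F and D = D and u = u and b = b, OF F] by blast
  have "of_int (poly r 0) = (of_int A :: complex)" unfolding r(2) using u(2) by simp
  then have "poly r 0 = A" by (simp only: of_int_eq_iff)
  then obtain G where G: "degree G \<le> degree r" "\<And>t. poly r (Q * t) = A * poly G t" "poly G 0 = 1"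
    "\<And>p t. prime p \<Longrightarrow> p \<le> W \<Longrightarrow> \<not> int p dvd poly G t"
    using line_values_factor[of r A W] u(3) unfolding Q_def by blast
  obtain \<rho> where \<rho>: "\<And>t. poly \<rho> t = \<phi> (\<lambda>i. of_int (u i) + t * of_int (Q * b i))"
    using line[of "\<lambda>i. of_int (u i)" "\<lambda>i. of_int (Q * b i)"] by blast
  \<comment> \<open>The point \<open>w'\<close> has parameter 1, so \<open>\<phi>\<close> is not
    identically zero on the line, and \<open>T\<close> can be put beyond all its zeros among the
    natural numbers.\<close>
  have "w' = (\<lambda>i. of_int (u i) + 1 * of_int (Q * b i))" using b(1) by auto
  then have "poly \<rho> 1 \<noteq> 0" using w'(3) unfolding \<rho> by simp
  then have "\<rho> \<noteq> 0" by auto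
  then have "finite {z. poly \<rho> z = 0}" by (rule poly_roots_finite)
  then have "finite (of_nat -` {z. poly \<rho> z = 0})" by (rule finite_vimageI) (simp add: inj_on_def)
  then obtain T where T: "\<And>t. t \<in> of_nat -` {z. poly \<rho> z = 0} \<Longrightarrow> t < T"
    unfolding finite_nat_set_iff_bounded by blast
  have "\<exists>s. \<not> int p dvd poly G s" if "prime p" for p
    using that G(3) by (intro exI[of _ 0]) (auto simp: prime_nat_iff)
  then obtain t where t: "t \<ge> T" "big_Omega (poly G (int t)) \<le> enat (120 * D\<^sup>2)"
    using almost_prime_values[where G = G and D = D and T = T] \<open>1 \<le> D\<close> le_trans[OF G(1) r(1)] G(4)
    unfolding W_def by blast
  let ?v = "\<lambda>i. u i + (Q * int t) * b i" and ?k = "A * poly G (int t)"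
  have "poly G (int t) \<noteq> 0" using t(2) by (auto simp: big_Omega_def)
  moreover have "poly \<rho> (of_nat t) \<noteq> 0" using T[of t] t(1) by auto
  then have "\<phi> (\<lambda>i. of_int (?v i)) \<noteq> 0" unfolding \<rho> by (simp add: mult_ac)
  moreover have "peval F (\<lambda>i. of_int (?v i)) = of_int ?k" by (simp only: r(2)[symmetric] G(2))
  moreover have "big_Omega ?k \<le> big_Omega A + enat (120 * D\<^sup>2)"
    using big_Omega_mult t(2) by (meson add_left_mono order_trans)
  moreover have "\<forall>i>m. ?v i = 0" using u(1) b(2) by simp
  ultimately show ?thesis using u(3) by (intro exI[of _ ?v] exI[of _ ?k]) simp
qed

section \<open>Integrality of the product form and prime factors of integral points\<close>

lemma peval_Ints:
  assumes "\<And>a. coefficient p a \<in> \<int>" "\<And>i. v i \<in> \<int>"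
  shows "peval p v \<in> \<int>"
  unfolding peval_def mon_eval_def using assms by (intro Ints_sum Ints_mult Ints_prod Ints_power)

lemma peval_prod: "peval (\<Prod>i\<in>A. f i) v = (\<Prod>i\<in>A. peval (f i) v)"
  by (induction A rule: infinite_finite_induct) (simp_all add: peval_mult)

lemma coefficient_forms: "p \<in> forms R n d \<Longrightarrow> 0 \<in> R \<Longrightarrow> coefficient p a \<in> R"
  by (cases "a \<in> monomials p") (auto simp: forms_def in_keys_iff)

lemma coefficient_mult_Ints:
  assumes "\<And>a. coefficient p a \<in> \<int>" "\<And>a. coefficient q a \<in> \<int>"
  shows "coefficient (p * q) c \<in> \<int>"
  by (subst cpoly_times_expand)
     (auto simp: lookup_sum lookup_single when_def intro!: Ints_sum Ints_mult assms)

lemma coefficient_prod_Ints: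
  assumes "\<And>i a. i \<in> A \<Longrightarrow> coefficient (f i) a \<in> \<int>"
  shows "coefficient (\<Prod>i\<in>A. f i) c \<in> \<int>"
  using assms
  by (induction A arbitrary: c rule: infinite_finite_induct)
     (auto simp: lookup_one when_def intro!: coefficient_mult_Ints)

lemma prod_forms_Rats:
  assumes "finite A" "\<And>i. i \<in> A \<Longrightarrow> f i \<in> forms \<int> m d"
  shows "(\<Prod>i\<in>A. f i) \<in> forms \<rat> m (card A * d)"
  using assms
proof (induction A rule: finite_induct)
  case (insert i A)
  have "f i \<in> forms \<rat> m d" using insert.prems[of i] using Ints_subset_Rats by (auto simp: forms_def)
  then show ?case using insert forms_mult_Rats by simp
qed (simp add: one_forms)

lemma total_degree_form:
  assumes "p \<in> forms R n d" "p \<noteq> 0"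
  shows "total_degree p = d"
proof -
  have "mon_degree ` monomials p = (\<lambda>_. d) ` monomials p"
    using assms(1) by (intro image_cong) (auto simp: forms_def)
  also have "\<dots> = {d}" using assms(2) by (simp add: image_constant_conv)
  finally have "mon_degree ` monomials p = {d}" .
  then show ?thesis by (simp add: total_degree_def)
qed

lemma max_coeff_ge_1:
  assumes "\<And>a. coefficient F a \<in> \<int>" "F \<noteq> 0"
  shows "1 \<le> max_coeff F"
proof -
  obtain a where a: "a \<in> monomials F" using assms(2) by fastforce
  obtain z where z: "coefficient F a = of_int z" using assms(1)[of a] by (auto elim: Ints_cases)
  then have "z \<noteq> 0" using a by (auto simp: in_keys_iff)
  then have "1 \<le> cmod (coefficient F a)" unfolding z by (simp add: norm_of_int)
  then show ?thesis using max_coeff_ge order_trans by blast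
qed

text \<open>Passing to primitive coordinates divides the \<open>a i\<close> by their gcd, which can
  only remove prime factors from the product.\<close>

lemma integral_point_Omega:
  fixes a :: "nat \<Rightarrow> int"
  assumes "\<And>i. i \<le> n \<Longrightarrow> a i \<noteq> 0"
  defines "x \<equiv> proj_point (\<lambda>i. if i \<le> n then of_int (a i) else 0)"
  shows "x \<in> rational_points n" "proj_Omega n x \<le> big_Omega (\<Prod>i\<le>n. a i)"
proof -
  have "(\<lambda>i. if i \<le> n then of_int (a i) else 0) \<in> vectors n"
    using assms(1)[of 0] by (auto simp: vectors_def)
  then show "x \<in> rational_points n"
    unfolding rational_points_def x_def by force
  define g where "g = Gcd (a ` {..n})"
  define c where "c i = a i div g" for i
  have "g \<noteq> 0" using assms(1)[of 0] by (auto simp: g_def)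
  have a: "a i = g * c i" if "i \<le> n" for i using that by (simp add: c_def g_def)
  have "g = Gcd ((\<lambda>i. g * c i) ` {..n})"
    unfolding g_def using a by (intro arg_cong[of _ _ Gcd] image_cong) (auto simp: g_def)
  also have "\<dots> = normalize (g * Gcd (c ` {..n}))"
    using Gcd_mult[of g "c ` {..n}"] by (simp add: image_image)
  also have "\<dots> = g * Gcd (c ` {..n})" by (simp add: normalize_mult g_def)
  finally have "Gcd (c ` {..n}) = 1" using \<open>g \<noteq> 0\<close> by simp
  moreover have "x = proj_point (\<lambda>i. if i \<le> n then of_int (c i) else 0)"
  proof -
    have "(\<lambda>i. if i \<le> n then of_int (a i) else 0) =
        (\<lambda>i. of_int g * (if i \<le> n then of_int (c i) else 0 :: complex))"
      using a by (auto simp: fun_eq_iff)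
    then show ?thesis unfolding x_def using proj_point_scale[of "of_int g"] \<open>g \<noteq> 0\<close> by simp
  qed
  ultimately have "primitive_coords n x c" by (simp add: primitive_coords_def)
  then have "proj_Omega n x = big_Omega (\<Prod>i\<le>n. c i)" by (rule proj_Omega_eq)
  also have "\<dots> \<le> big_Omega (\<Prod>i\<le>n. a i)"
    using a by (intro big_Omega_dvd_mono prod_dvd_prod) auto
  finally show "proj_Omega n x \<le> big_Omega (\<Prod>i\<le>n. a i)" .
qed

text \<open>The closure of the almost prime points is cut out by forms \<open>g\<close>. If the
  pullback of some \<open>g\<close> to the source were not identically zero, there would be an
  integral point of the source off its zero set whose image is almost prime and so lies in the
  closure, a contradiction. Hence every \<open>g\<close> vanishes on the image of the map, and
  dominance extends this to \<open>X\<close>.\<close>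

lemma zariski_dense_almost_prime_points:
  assumes dom: "dominant_map \<int> m n d f X" and "1 \<le> D"
    and F: "F = (\<Prod>i\<le>n. f i)" "F \<in> forms \<rat> m D" "\<And>a. coefficient F a \<in> \<int>"
    and u: "\<And>i. i > m \<Longrightarrow> u i = 0" "peval F (\<lambda>i. of_int (u i)) = of_int A" "A \<noteq> 0"
    and R: "big_Omega A + enat (120 * D\<^sup>2) \<le> R"
  shows "zariski_dense n X {x \<in> X \<inter> rational_points n. proj_Omega n x \<le> R}" (is "zariski_dense n X ?T")
proof -
  let ?f = "\<lambda>v i. if i \<le> n then peval (f i) v else 0"
  have f: "f i \<in> forms \<int> m d" if "i \<le> n" for i using dom that by (simp add: dominant_map_def)
  have img: "rational_image m n f \<subseteq> X" "X \<subseteq> zariski n closure_of (rational_image m n f)"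
    using dom by (auto simp: dominant_map_def zariski_dense_def)
  have X: "X \<subseteq> proj_space n"
    using img(2) closure_of_subset_topspace[of "zariski n"] topspace_zariski by blast
  then have T: "?T \<subseteq> zariski n closure_of ?T"
    using topspace_zariski by (intro closure_of_subset) auto
  obtain H where H: "H \<subseteq> (\<Union>e. forms \<rat> n e)" "zariski n closure_of ?T = zero_locus n H"
    using closedin_closure_of[of "zariski n" ?T] unfolding closedin_zariski by blast
  have "peval g (?f w) = 0" if g: "g \<in> H" and w: "w \<in> vectors m" for g w
  proof (rule ccontr)
    assume nz: "peval g (?f w) \<noteq> 0"
    have line: "\<exists>r. \<forall>t. poly r t = peval g (?f (\<lambda>i. y i + t * b i))" for y b
    proof -
      \<comment> \<open>Substitution in two stages: the line into each \<open>f i\<close>, then the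
        resulting univariate polynomials into \<open>g\<close>.\<close>
      let ?q = "\<lambda>i. if i \<le> n then poly_subst (monomials (f i)) (coefficient (f i)) (\<lambda>j. [:y j, b j:]) else 0"
      have "(\<lambda>i. poly (?q i) t) = ?f (\<lambda>i. y i + t * b i)" for t
        by (auto simp: poly_poly_subst_complex)
      then have "poly (poly_subst (monomials g) (coefficient g) ?q) t = peval g (?f (\<lambda>i. y i + t * b i))" for t
        by (simp only: poly_poly_subst_complex)
      then show ?thesis by blast
    qed
    have deg: "mon_degree a \<le> D" if "a \<in> monomials F" for a using F(2) that by (simp add: forms_def)
    have w0: "w i = 0" if "i > m" for i using w that by (simp add: vectors_def)
    obtain v k where v: "\<And>i. i > m \<Longrightarrow> v i = 0" "peval g (?f (\<lambda>i. of_int (v i))) \<noteq> 0"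
      and k: "k \<noteq> 0" "peval F (\<lambda>i. of_int (v i)) = of_int k" "big_Omega k \<le> big_Omega A + enat (120 * D\<^sup>2)"
      using almost_prime_point[where \<phi> = "\<lambda>v. peval g (?f v)", OF F(3) deg \<open>1 \<le> D\<close> u w0 nz line]
      by blast
    let ?v = "\<lambda>i. of_int (v i) :: complex"
    have "peval (f i) ?v \<in> \<int>" if "i \<le> n" for i
      using coefficient_forms[OF f[OF that]] by (intro peval_Ints) auto
    then have "\<exists>z. i \<le> n \<longrightarrow> peval (f i) ?v = of_int z" for i by (metis Ints_cases)
    then obtain a where a: "\<And>i. i \<le> n \<Longrightarrow> peval (f i) ?v = of_int (a i)" by metis
    \<comment> \<open>As \<open>F\<close> is the product of the \<open>f i\<close>, the number
      \<open>k\<close> is exactly the product of the integral coordinates of the image.\<close>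
    have "of_int k = (of_int (\<Prod>i\<le>n. a i) :: complex)"
      unfolding k(2)[symmetric] F(1) peval_prod by (simp add: a)
    then have prod: "k = (\<Prod>i\<le>n. a i)" by (simp only: of_int_eq_iff)
    then have a0: "a i \<noteq> 0" if "i \<le> n" for i using k(1) that by auto
    have fa: "?f ?v = (\<lambda>i. if i \<le> n then of_int (a i) else 0)" using a by auto
    have "?v \<in> vectors m"
    proof (rule ccontr)
      assume "?v \<notin> vectors m"
      moreover have "?v \<in> vectors m" if "v i \<noteq> 0" "i \<le> m" for i
        using that v(1) unfolding vectors_def by auto
      ultimately have "v i = 0" for i using v(1)[of i] not_le by blast
      \<comment> \<open>A form of positive degree vanishes at the origin.\<close>
      then have "peval F ?v = 0" using peval_scale[OF F(2), of 0 ?v] \<open>1 \<le> D\<close> by (simp add: zero_power)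
      then show False using k by simp
    qed
    moreover have "\<exists>i\<le>n. peval (f i) ?v \<noteq> 0" using a[of 0] a0[of 0] by (intro exI[of _ 0]) simp
    ultimately have "proj_point (?f ?v) \<in> rational_image m n f" unfolding rational_image_def by blast
    moreover have "proj_Omega n (proj_point (?f ?v)) \<le> big_Omega k"
      unfolding fa prod by (rule integral_point_Omega(2)) (rule a0)
    then have "proj_Omega n (proj_point (?f ?v)) \<le> R" using k(3) R by (meson order_trans)
    moreover have "proj_point (?f ?v) \<in> rational_points n"
      unfolding fa by (rule integral_point_Omega(1)) (rule a0)
    ultimately have "proj_point (?f ?v) \<in> zero_locus n H" using T img(1) H(2) by blast
    then have "peval g (?f ?v) = 0" using g proj_point_self by (auto simp: zero_locus_def)
    then show False using v(2) by simp
  qed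
  then have "rational_image m n f \<subseteq> zero_locus n H"
  proof (intro subsetI)
    fix x assume x: "x \<in> rational_image m n f"
      and vanish: "\<And>g w. g \<in> H \<Longrightarrow> w \<in> vectors m \<Longrightarrow> peval g (?f w) = 0"
    then obtain w where w: "w \<in> vectors m" "x = proj_point (?f w)" unfolding rational_image_def by blast
    have "\<forall>v\<in>x. peval g v = 0" if g: "g \<in> H" for g
    proof -
      obtain e where "g \<in> forms \<rat> n e" using H(1) g by blast
      from vanishing_rep[OF this w(2), of "?f w"] show ?thesis
        using vanish[OF g w(1)] proj_point_self w(2) by blast
    qed
    then show "x \<in> zero_locus n H" using x img(1) X by (auto simp: zero_locus_def)
  qed
  then have "zariski n closure_of (rational_image m n f) \<subseteq> zariski n closure_of ?T"
    unfolding H(2)[symmetric] by (intro closure_of_minimal closedin_closure_of)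
  then show ?thesis using img(2) unfolding zariski_dense_def by blast
qed

theorem theorem1p4:
  fixes n m d :: nat and X :: "ppoint set" and f :: "nat \<Rightarrow> cpoly" and F :: cpoly
  assumes "proj_variety n X" and "smooth_variety n X" and "unirational n X"
    and "1 \<le> m" and "1 \<le> d" and "dominant_map \<int> m n d f X"
    and "F = (\<Prod>i\<le>n. f i)" and "F \<noteq> 0"
  shows "ereal_of_enat (saturation_number n X)
           \<le> ereal (10 ^ 5 * real (total_degree F) ^ 7 * ln (2 * max_coeff F))"
proof -
  let ?D = "total_degree F" and ?M = "max_coeff F"
  have f: "f i \<in> forms \<int> m d" if "i \<le> n" for i using assms(6) that by (simp add: dominant_map_def)
  have coeffs: "coefficient F a \<in> \<int>" for a
    unfolding assms(7) using f by (intro coefficient_prod_Ints coefficient_forms) auto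
  have "F \<in> forms \<rat> m (Suc n * d)"
    unfolding assms(7) using prod_forms_Rats[of "{..n}" f m d] f by simp
  moreover from this assms(8) have "?D = Suc n * d" by (rule total_degree_form)
  ultimately have F: "F \<in> forms \<rat> m ?D" and D: "1 \<le> ?D" using assms(5) by simp_all
  have M: "1 \<le> ?M" using coeffs assms(8) by (rule max_coeff_ge_1)
  obtain v :: "nat \<Rightarrow> nat" where v: "\<And>i. i > m \<Longrightarrow> v i = 0" "peval F (\<lambda>i. of_nat (v i)) \<noteq> 0"
    "cmod (peval F (\<lambda>i. of_nat (v i))) \<le> 2 ^ (2 * ?D\<^sup>2) * ?M"
    using small_nonzero_value[OF assms(8) D, of m] F by (auto simp: forms_def)
  have "peval F (\<lambda>i. of_nat (v i)) \<in> \<int>" using coeffs by (intro peval_Ints) auto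
  then obtain A where A: "peval F (\<lambda>i. of_nat (v i)) = of_int A" by (auto elim: Ints_cases)
  then have A0: "A \<noteq> 0" using v(2) by auto
  \<comment> \<open>The number of prime factors of the fixed factor F(u), bounded through 2^s \<le>
    |A|.\<close>
  define s where "s = size (prime_factorization A)"
  have "(2::int) ^ s \<le> prod_mset (prime_factorization A)"
    unfolding s_def by (intro power_size_le_prod_mset) (auto simp: in_prime_factors_iff intro: prime_ge_2_int)
  also have "\<dots> = \<bar>A\<bar>" using A0 by (simp add: prod_mset_prime_factorization)
  finally have "real_of_int (2 ^ s) \<le> real_of_int \<bar>A\<bar>" by (simp only: of_int_le_iff)
  also have "\<dots> \<le> 2 ^ (2 * ?D\<^sup>2) * ?M" using v(3) unfolding A by simp
  finally have "2 ^ s \<le> 2 ^ (2 * ?D\<^sup>2) * ?M" by simp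
  then have "ln (2 ^ s) \<le> ln (2 ^ (2 * ?D\<^sup>2) * ?M)" using M by (subst ln_le_cancel_iff) auto
  then have s: "s * ln 2 \<le> 2 * (real ?D)\<^sup>2 * ln 2 + ln ?M"
    using M by (simp add: ln_mult ln_realpow)
  let ?r = "s + 120 * ?D\<^sup>2"
  have "zariski_dense n X {x \<in> X \<inter> rational_points n. proj_Omega n x \<le> enat ?r}"
  proof (rule zariski_dense_almost_prime_points[OF assms(6) D assms(7) F coeffs])
    show "peval F (\<lambda>i. of_int (int (v i))) = of_int A" using A by simp
    show "big_Omega A + enat (120 * ?D\<^sup>2) \<le> enat ?r" using A0 by (simp add: big_Omega_size s_def)
  qed (use v(1) A0 in auto)
  then have "saturation_number n X \<le> enat ?r"
    unfolding saturation_number_def by (intro Inf_lower) simp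
  then have "ereal_of_enat (saturation_number n X) \<le> ereal_of_enat (enat ?r)"
    by (simp only: ereal_of_enat_le_iff)
  also have "\<dots> = ereal (real ?r)" by simp
  also have "\<dots> \<le> ereal (10 ^ 5 * real ?D ^ 7 * ln (2 * ?M))"
  proof -
    let ?d = "real ?D" and ?L = "ln (2 * ?M)"
    \<comment> \<open>With ln 2 \<ge> 1/2 the bound on \<open>s\<close> becomes 2 D^2 + 2 ln
      \<open>?M\<close>, so \<open>?r\<close> is at most 122 D^2 + 2 L. Moreover L \<ge> 1/2 gives
      D^2 \<le> 2 D^7 L, whence the 244.\<close>
    have ln2: "1 / 2 \<le> ln (2::real)" using ln2_ge_two_thirds by linarith
    have L: "?L = ln 2 + ln ?M" "0 \<le> ln ?M" using M by (simp_all add: ln_mult)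
    have d: "1 \<le> ?d" using D by simp
    have "(s - 2 * ?d\<^sup>2) * (1 / 2) \<le> ln ?M"
    \<comment> \<open>Replacing ln 2 by 1/2 lowers the product only if the first factor is
      nonnegative; otherwise the left side is at most 0.\<close>
    proof (cases "s \<le> 2 * ?d\<^sup>2")
      case True
      then have "(s - 2 * ?d\<^sup>2) * (1 / 2) \<le> 0" by simp
      then show ?thesis using L(2) by linarith
    next
      case False
      then have "(s - 2 * ?d\<^sup>2) * (1 / 2) \<le> (s - 2 * ?d\<^sup>2) * ln 2" using ln2 by (intro mult_left_mono) auto
      also have "\<dots> \<le> ln ?M" using s by (simp add: algebra_simps)
      finally show ?thesis .
    qed
    then have "real ?r \<le> 122 * ?d\<^sup>2 + 2 * ?L" using L ln2 by (simp add: algebra_simps)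
    also have "\<dots> \<le> 244 * (?d ^ 7 * ?L) + 2 * (?d ^ 7 * ?L)"
    proof -
      have "?d\<^sup>2 \<le> ?d ^ 7" using d by (intro power_increasing) auto
      then have "?d\<^sup>2 * (1 / 2) \<le> ?d ^ 7 * ?L" using L ln2 by (intro mult_mono) auto
      moreover have "1 * ?L \<le> ?d ^ 7 * ?L"
        using d L ln2 by (intro mult_right_mono one_le_power) auto
      ultimately show ?thesis by linarith
    qed
    also have "\<dots> \<le> 10 ^ 5 * (?d ^ 7 * ?L)"
    proof -
      have "0 \<le> ?d ^ 7 * ?L" using L ln2 by (intro mult_nonneg_nonneg) auto
      moreover have "244 * x + 2 * x \<le> 10 ^ 5 * x" if "0 \<le> x" for x :: real using that by simp
      ultimately show ?thesis by blast
    qed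
    finally show ?thesis by (simp add: mult.assoc)
  qed
  finally show ?thesis .
qed

end
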